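(* For each $i\in I$, the restriction of $\Lambda\circ\Theta_i$ to $\mathcal M$ is the Chari operator $T_i$, i.e. the group automorphism of $\mathcal M$ given by $$T_i(Y_{j,a})=Y_{j,a}A_{i,aq_i^{-1}}^{-\delta_{i,j}}\qquad(j\in I,\ a\in\mathbb C^\times).$$
   Context: Lie algebra data. Let $\mathfrak g$ be a finite-dimensional simple Lie algebra over $\mathbb C$ of rank $n$, $I=\{1,\dots,n\}$, with Cartan matrix $C=(C_{i,j})$ (conventions of Kac), simple roots $\alpha_i$, fundamental weights $\omega_i$ (so $\alpha_i=\sum_{j}C_{j,i}\omega_j$), weight lattice $P=\bigoplus_i\mathbb Z\omega_i$, $Q^+=\bigoplus_i\mathbb Z_{\ge0}\alpha_i$, roots $\Delta=\Delta_+\sqcup\Delta_-$, Weyl group $W$ with simple reflections $s_i$ and identity $e$; $\omega\le\omega'$ in $P$ iff $\omega'-\omega\in Q^+$. Let $d_i$ be relatively prime positive integers with $\mathrm{diag}(d_i)\,C$ symmetric. Fix $q\in\mathbb C^\times$ not a root of unity, $q_i=q^{d_i}$. $\mathcal Y=\mathbb Z[Y_{i,a}^{\pm1}]_{i\in I,a\in\mathbb C^\times}$; $\mathcal M$ is its multiplicative group of (Laurent) monomials; $\omega(\prod Y_{i,a}^{u_{i,a}})=\sum u_{i,a}\omega_i$. Put $$A_{i,a}=Y_{i,aq_i^{-1}}Y_{i,aq_i}\Big(\prod_{j:\,C_{j,i}=-1}Y_{j,a}\prod_{j:\,C_{j,i}=-2}Y_{j,aq^{-1}}Y_{j,aq}\prod_{j:\,C_{j,i}=-3}Y_{j,aq^{-2}}Y_{j,a}Y_{j,aq^2}\Big)^{-1}.$$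 For $w\in W$, $\widetilde{\mathcal Y}^w$ is the ring of formal series $\sum_{m\in S}a_mm$ ($a_m\in\mathbb Z$, $S\subset\mathcal M$) such that all $w(\omega(m))$, $m\in S$, lie in a finite union of sets $\lambda_j-Q^+$ ($\lambda_j\in P$), with finitely many $m$ with $a_m\ne0$ of each given weight. $\Pi=\bigoplus_{w\in W}\widetilde{\mathcal Y}^w$, with diagonal embedding $\mathcal Y\hookrightarrow\Pi$, projections $E_w:\Pi\to\widetilde{\mathcal Y}^w$, and automorphisms $\tau_a$ ($a\in\mathbb C^\times$) with $\tau_a(Y_{i,b})=Y_{i,ab}$. $\Sigma_{i,a}^+=\sum_{k\ge0}\prod_{0<j\le k}A_{i,aq_i^{-2j+2}}^{-1}$ and $\Sigma_{i,a}^-=-\sum_{k>0}\prod_{0<j\le k}A_{i,aq_i^{2j}}$; $\Sigma^w_{i,a}\in\widetilde{\mathcal Y}^w$ is $\Sigma^+_{i,a}$ if $w(\alpha_i)\in\Delta_+$ and $\Sigma^-_{i,a}$ if $w(\alpha_i)\in\Delta_-$. The ring homomorphism $\Theta_i^w:\widetilde{\mathcal Y}^w\to\widetilde{\mathcal Y}^{ws_i}$ is defined, termwise on formal series, by $\Theta_i^w(Y_{j,a}^{\pm1})=Y_{j,a}^{\pm1}$ for $j\ne i$ and $\Theta_i^w(Y_{i,a})=Y_{i,a}A_{i,aq_i^{-1}}^{-1}\Sigma^{ws_i}_{i,aq_i^{-3}}/\Sigma^{ws_i}_{i,aq_i^{-1}}$; $\Theta_i:\Pi\to\Pi$ is the direct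 sum over $w$ (the $ws_i$-component of $\Theta_i(f)$ is $\Theta_i^w(f_w)$). The algebra $\overline{\mathcal Y}$. For $\alpha=\sum c_i\alpha_i\in\Delta$ put $a_\alpha=\prod_i a_i^{c_i}$, with $a_i=\prod_jy_j^{C_{j,i}}$. Let $(\mathbb Z[y_i^{\pm1}])^w=\mathbb Z[y_i^{\pm1}]_{i\in I}\otimes_{\mathbb Z[a_{w^{-1}(\alpha_i)}^{\pm1}]_{i\in I}}\mathbb Z((a^{-1}_{w^{-1}(\alpha_i)}))_{i\in I}$ and let $\varpi_w:\widetilde{\mathcal Y}^w\to(\mathbb Z[y_i^{\pm1}])^w$ be the ring homomorphism with $Y_{i,a}\mapsto y_i$. Let $\widetilde G^w\subset(\widetilde{\mathcal Y}^w)^\times$ be the subgroup of elements $A\cdot S$ with $A\in\mathcal M$, $S=\pm1+\sum_{w(\omega(m))<0}a_mm$. Define inductively $\mathcal Y$-subalgebras $\mathcal Y^m\subset\Pi$ and subgroups $G^m\subset(\mathcal Y^m)^\times$ with $E_w(G^m)\subset\widetilde G^w$ for all $w$: $\mathcal Y^0$, $G^0$ are the diagonal images of $\mathcal Y$, $\mathcal M$. Let $(G^m)^{adm}$ be the set of $g\in G^m$ such that for all $w\in W$, $\varpi_w(E_w(g))=a_\alpha$ for some $\alpha\in\Delta$. For $g\in(G^m)^{adm}$, $r\in\mathbb Z\setminus\{0\}$, let $(f_{g,r}(a))_{a\in\mathbb C^\times}$ be the unique family of invertible elements of $\Pi$, equivariant in the sense that $\tau_b(f_{g,r}(a))=f_{g,r}(ab)$,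 satisfying $f_{g,r}(a)=1+\tau_a(g)f_{g,r}(aq^{-r})$. Then $\mathcal Y^{m+1}$ is the $\mathcal Y^m$-subalgebra of $\Pi$ generated by all $f_{g,r}(a)^{\pm1}$, and $G^{m+1}$ is the group generated by $G^m$ and all $f_{g,r}(a)$. Put $\overline{\mathcal Y}=\bigcup_m\mathcal Y^m$. $\overline{\mathcal M}$ is the subgroup of invertible elements of $\overline{\mathcal Y}$ generated by $\mathcal M$ and all $G^m$, $m\ge0$; $\Theta_i$ defines an automorphism of $\overline{\mathcal M}$. The truncation homomorphism $\Lambda:\overline{\mathcal M}\to\mathcal M$ assigns to $P$ the unique $\Lambda(P)\in\mathcal M$ such that $E_e(P)=\Lambda(P)\cdot\overline P$ with $\overline P\in\mathbb Z[[A_{j,b}^{-1}]]_{j\in I,b\in\mathbb C^\times}$ having constant term $\pm1$. *)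

theory Defs
  imports
    "HOL-Analysis.Finite_Cartesian_Product"
    "HOL-Library.Poly_Mapping"
    "HOL-Algebra.Generated_Groups"
    "HOL-Algebra.Generated_Rings"
begin

typedef cstar = "{z :: complex. z \<noteq> 0}"
  morphisms complex_of_cstar Abs_cstar
  by (rule exI[of _ 1]) simp

setup_lifting type_definition_cstar

instantiation cstar :: "{comm_monoid_mult, inverse}"
begin

lift_definition one_cstar :: cstar is 1 by simp
lift_definition times_cstar :: "cstar \<Rightarrow> cstar \<Rightarrow> cstar" is "(*)" by simp
lift_definition inverse_cstar :: "cstar \<Rightarrow> cstar" is inverse by simp
lift_definition divide_cstar :: "cstar \<Rightarrow> cstar \<Rightarrow> cstar" is "(/)" by simp

instance by standard (transfer; simp add: mult.assoc mult.commute)+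

end

locale simple_lie_algebra = vector_space sc
  for sc :: "complex \<Rightarrow> 'g::ab_group_add \<Rightarrow> 'g" +
  fixes br :: "'g \<Rightarrow> 'g \<Rightarrow> 'g"
  assumes br_linear_right: "Vector_Spaces.linear sc sc (\<lambda>y. br x y)"
    and br_linear_left: "Vector_Spaces.linear sc sc (\<lambda>x. br x y)"
    and br_self: "br x x = 0"
    and br_jacobi: "br x (br y z) + br y (br z x) + br z (br x y) = 0"
    and finite_dim: "\<exists>B. finite B \<and> span B = UNIV"
    and not_abelian: "\<exists>x y. br x y \<noteq> 0"
    and no_proper_ideal:
      "\<lbrakk>subspace J; \<And>x y. y \<in> J \<Longrightarrow> br x y \<in> J\<rbrakk> \<Longrightarrow> J = {0} \<or> J = UNIV"

text \<open>
  Kac's notion of the Cartan matrix of \<open>\<gg>\<close> (index set: the finite type \<open>'i\<close>, so the rank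
  is \<open>CARD('i)\<close>): \<open>C $ i $ j\<close> is the value of the simple root \<open>\<alpha>\<^sub>j\<close> on the simple coroot \<open>h i\<close>,
  and \<open>e i\<close>, \<open>f i\<close>, \<open>h i\<close> are Chevalley generators. The Cartan subalgebra is the span of the \<open>h i\<close>.
\<close>

locale simple_lie_algebra_cartan = simple_lie_algebra sc br
  for sc :: "complex \<Rightarrow> 'g::ab_group_add \<Rightarrow> 'g" and br :: "'g \<Rightarrow> 'g \<Rightarrow> 'g" +
  fixes C :: "int ^ 'i::finite ^ 'i"
    and h e f :: "'i \<Rightarrow> 'g"
  assumes C_diag: "C $ i $ i = 2"
    and C_offdiag: "i \<noteq> j \<Longrightarrow> C $ i $ j \<le> 0"
    and C_zero: "C $ i $ j = 0 \<Longrightarrow> C $ j $ i = 0"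
    and h_independent: "inj h" "independent (range h)"
    and br_h_h: "br (h i) (h j) = 0"
    and br_h_e: "br (h i) (e j) = sc (of_int (C $ i $ j)) (e j)"
    and br_h_f: "br (h i) (f j) = sc (- of_int (C $ i $ j)) (f j)"
    and br_e_f: "br (e i) (f j) = (if i = j then h i else 0)"
    and generated:
      "\<lbrakk>subspace S; \<And>x y. x \<in> S \<Longrightarrow> y \<in> S \<Longrightarrow> br x y \<in> S; range e \<subseteq> S; range f \<subseteq> S\<rbrakk> \<Longrightarrow> S = UNIV"

text \<open>
  A weight \<open>\<Sum>\<^sub>i \<lambda>\<^sub>i \<omega>\<^sub>i\<close> of \<open>P\<close> is represented by the vector of its coordinates \<open>\<lambda>\<^sub>i\<close>, which are its
  values on the simple coroots. All roots are integral, hence lie in \<open>P\<close>.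
\<close>

type_synonym 'i weight = "int ^ 'i"

definition lie_roots ::
  "(complex \<Rightarrow> 'g::ab_group_add \<Rightarrow> 'g) \<Rightarrow> ('g \<Rightarrow> 'g \<Rightarrow> 'g) \<Rightarrow> ('i::finite \<Rightarrow> 'g) \<Rightarrow> 'i weight set" where
  "lie_roots sc br h =
     {\<alpha>. \<alpha> \<noteq> 0 \<and> (\<exists>x. x \<noteq> 0 \<and> (\<forall>i. br (h i) x = sc (of_int (\<alpha> $ i)) x))}"

definition is_symmetrizer :: "int ^ 'i::finite ^ 'i \<Rightarrow> ('i \<Rightarrow> nat) \<Rightarrow> bool" where
  "is_symmetrizer C d \<longleftrightarrow> (\<forall>i. d i > 0) \<and> Gcd (range d) = 1 \<and>
     (\<forall>i j. int (d i) * C $ i $ j = int (d j) * C $ j $ i)"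

text \<open>
  The Laurent monomial \<open>\<Prod> Y\<^sub>i\<^sub>,\<^sub>a ^ u\<^sub>i\<^sub>,\<^sub>a\<close> is represented by its exponent function \<open>u\<close>, so the
  group of monomials is written additively. A formal series \<open>\<Sum> a\<^sub>m m\<close> is its coefficient function.
\<close>

type_synonym 'i monomial = "('i \<times> cstar) \<Rightarrow>\<^sub>0 int"
type_synonym 'i series = "'i monomial \<Rightarrow> int"

definition monomial_group :: "'i monomial monoid" where
  "monomial_group = \<lparr>carrier = UNIV, mult = (+), one = 0\<rparr>"

definition Y :: "'i \<Rightarrow> cstar \<Rightarrow> 'i monomial" where
  "Y i a = Poly_Mapping.single (i, a) 1"

definition wt :: "'i::finite monomial \<Rightarrow> 'i weight" where
  "wt m = (\<chi> i. \<Sum>(j, a)\<in>Poly_Mapping.keys m.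
                  if j = i then Poly_Mapping.lookup m (j, a) else 0)"

definition mono_series :: "'i monomial \<Rightarrow> 'i series" where
  "mono_series m = (\<lambda>m'. if m' = m then 1 else 0)"

text \<open>The sum below is finite whenever both factors lie in the same ring \<open>Ytilde w\<close>.\<close>

definition series_mult :: "'i series \<Rightarrow> 'i series \<Rightarrow> 'i series" where
  "series_mult f g = (\<lambda>m. \<Sum>m' | f m' \<noteq> 0 \<and> g (m - m') \<noteq> 0. f m' * g (m - m'))"

text \<open>
  The map \<open>\<varpi>\<^sub>w\<close> (\<open>Y\<^sub>i\<^sub>,\<^sub>a \<mapsto> y\<^sub>i\<close>). Since \<open>\<int>[y\<^sub>i\<^sup>\<plusminus>]\<close> is free over \<open>\<int>[a\<^sub>i\<^sup>\<plusminus>]\<close>, with basis the \<open>y\<close>-monomials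
  representing \<open>P / Q\<close>, the tensor product in which \<open>\<varpi>\<^sub>w\<close> takes its values consists of the formal
  series \<open>\<Sum> c\<^sub>\<lambda> y^\<lambda>\<close> (\<open>\<lambda> \<in> P\<close>, \<open>y^\<lambda> = \<Prod> y\<^sub>i ^ \<lambda>\<^sub>i\<close>) such that the \<open>w \<lambda>\<close> with \<open>c\<^sub>\<lambda> \<noteq> 0\<close> lie in a finite
  union of sets \<open>\<lambda>\<^sub>j - Q\<^sup>+\<close>. Such a series is given by its coefficient function on \<open>P\<close>, and the
  formula for \<open>\<varpi>\<^sub>w\<close> does not depend on \<open>w\<close>. For \<open>\<alpha> = \<Sum> c\<^sub>i \<alpha>\<^sub>i\<close> one has
  \<open>a\<^sub>\<alpha> = \<Prod>\<^sub>i \<Prod>\<^sub>j y\<^sub>j ^ (C\<^sub>j\<^sub>i c\<^sub>i) = y^\<alpha>\<close>.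
\<close>

definition varpi :: "'i::finite series \<Rightarrow> 'i weight \<Rightarrow> int" where
  "varpi f = (\<lambda>\<mu>. \<Sum>m | wt m = \<mu> \<and> f m \<noteq> 0. f m)"

definition a_root :: "'i::finite weight \<Rightarrow> 'i weight \<Rightarrow> int" where
  "a_root \<alpha> = (\<lambda>\<mu>. if \<mu> = \<alpha> then 1 else 0)"

locale cartan_setting =
  fixes C :: "int ^ 'i::finite ^ 'i"
    and d :: "'i \<Rightarrow> nat"
    and q :: cstar
    and \<Delta> :: "'i weight set"
begin

definition simple_root :: "'i \<Rightarrow> 'i weight" where
  "simple_root i = (\<chi> j. C $ j $ i)"

definition Q_plus :: "'i weight set" where
  "Q_plus = {(\<chi> j. \<Sum>i\<in>UNIV. int (c i) * simple_root i $ j) | c :: 'i \<Rightarrow> nat. True}"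

definition pos_roots :: "'i weight set" where
  "pos_roots = \<Delta> \<inter> Q_plus"

definition refl :: "'i \<Rightarrow> 'i weight \<Rightarrow> 'i weight" where
  "refl i \<mu> = (\<chi> j. \<mu> $ j - \<mu> $ i * simple_root i $ j)"

text \<open>The simple reflections are involutions, so closure under inverses is automatic.\<close>

inductive_set weyl :: "('i weight \<Rightarrow> 'i weight) set" where
  weyl_id: "id \<in> weyl"
| weyl_refl: "w \<in> weyl \<Longrightarrow> w \<circ> refl i \<in> weyl"

definition qi :: "'i \<Rightarrow> cstar" where
  "qi i = q ^ d i"

definition A :: "'i \<Rightarrow> cstar \<Rightarrow> 'i monomial" where
  "A i a = Y i (a * qi i powi (-1)) + Y i (a * qi i)
     - ((\<Sum>j | C $ j $ i = -1. Y j a)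
      + (\<Sum>j | C $ j $ i = -2. Y j (a * q powi (-1)) + Y j (a * q))
      + (\<Sum>j | C $ j $ i = -3. Y j (a * q powi (-2)) + Y j a + Y j (a * q powi 2)))"

definition Ytilde :: "('i weight \<Rightarrow> 'i weight) \<Rightarrow> 'i series ring" where
  "Ytilde w = \<lparr>
     carrier = {f. (\<exists>L. finite L \<and> (\<forall>m. f m \<noteq> 0 \<longrightarrow> (\<exists>\<mu>\<in>L. \<exists>\<beta>\<in>Q_plus. w (wt m) = \<mu> - \<beta>)))
                 \<and> (\<forall>\<mu>. finite {m. f m \<noteq> 0 \<and> wt m = \<mu>})},
     mult = series_mult,
     one = mono_series 0,
     zero = (\<lambda>_. 0),
     add = (\<lambda>f g m. f m + g m)\<rparr>"

text \<open>The ring \<open>\<Pi>\<close>; the projection \<open>E\<^sub>w\<close> is evaluation at \<open>w\<close>.\<close>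

definition Pi_ring :: "(('i weight \<Rightarrow> 'i weight) \<Rightarrow> 'i series) ring" where
  "Pi_ring = \<lparr>
     carrier = (\<Pi>\<^sub>E w\<in>weyl. carrier (Ytilde w)),
     mult = (\<lambda>F G. \<lambda>w\<in>weyl. F w \<otimes>\<^bsub>Ytilde w\<^esub> G w),
     one = (\<lambda>w\<in>weyl. \<one>\<^bsub>Ytilde w\<^esub>),
     zero = (\<lambda>w\<in>weyl. \<zero>\<^bsub>Ytilde w\<^esub>),
     add = (\<lambda>F G. \<lambda>w\<in>weyl. F w \<oplus>\<^bsub>Ytilde w\<^esub> G w)\<rparr>"

definition diag :: "'i series \<Rightarrow> ('i weight \<Rightarrow> 'i weight) \<Rightarrow> 'i series" where
  "diag f = (\<lambda>w\<in>weyl. f)"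

text \<open>
  The coefficient of \<open>\<tau>\<^sub>a(f)\<close> at \<open>m\<close> is that of \<open>f\<close> at \<open>\<tau>\<^bsub>1/a\<^esub>(m)\<close>, whose exponent at \<open>(i, b)\<close> is
  the exponent of \<open>m\<close> at \<open>(i, a b)\<close>.
\<close>

definition tau :: "cstar \<Rightarrow> (('i weight \<Rightarrow> 'i weight) \<Rightarrow> 'i series)
                        \<Rightarrow> ('i weight \<Rightarrow> 'i weight) \<Rightarrow> 'i series" where
  "tau a F = (\<lambda>w\<in>weyl. \<lambda>m. F w (Poly_Mapping.map_key (\<lambda>(i, b). (i, a * b)) m))"

text \<open>The products of the \<open>A\<close>'s indexed by different \<open>k\<close> are different monomials.\<close>

definition Sigma_plus :: "'i \<Rightarrow> cstar \<Rightarrow> 'i series" where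
  "Sigma_plus i a = (\<lambda>m. int (card {k::nat.
     m = (\<Sum>j\<in>{0<..k}. - A i (a * qi i powi (- 2 * int j + 2)))}))"

definition Sigma_minus :: "'i \<Rightarrow> cstar \<Rightarrow> 'i series" where
  "Sigma_minus i a = (\<lambda>m. - int (card {k::nat. k > 0 \<and>
     m = (\<Sum>j\<in>{0<..k}. A i (a * qi i powi (2 * int j)))}))"

definition Sigma_w :: "('i weight \<Rightarrow> 'i weight) \<Rightarrow> 'i \<Rightarrow> cstar \<Rightarrow> 'i series" where
  "Sigma_w w i a = (if w (simple_root i) \<in> pos_roots then Sigma_plus i a else Sigma_minus i a)"

definition Theta_gen :: "'i \<Rightarrow> ('i weight \<Rightarrow> 'i weight) \<Rightarrow> 'i \<times> cstar \<Rightarrow> 'i series" where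
  "Theta_gen i w = (\<lambda>(j, a).
     if j \<noteq> i then mono_series (Y j a)
     else (let R = Ytilde (w \<circ> refl i) in
       mono_series (Y i a - A i (a * qi i powi (-1)))
         \<otimes>\<^bsub>R\<^esub> Sigma_w (w \<circ> refl i) i (a * qi i powi (-3))
         \<otimes>\<^bsub>R\<^esub> inv\<^bsub>R\<^esub> (Sigma_w (w \<circ> refl i) i (a * qi i powi (-1)))))"

definition Theta_monomial :: "'i \<Rightarrow> ('i weight \<Rightarrow> 'i weight) \<Rightarrow> 'i monomial \<Rightarrow> 'i series" where
  "Theta_monomial i w m =
     (\<Otimes>\<^bsub>Ytilde (w \<circ> refl i)\<^esub> p \<in> Poly_Mapping.keys m.
        Theta_gen i w p [^]\<^bsub>Ytilde (w \<circ> refl i)\<^esub> Poly_Mapping.lookup m p)"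

text \<open>Only finitely many terms of a series in \<open>Ytilde w\<close> contribute to a given coefficient.\<close>

definition Theta_w :: "'i \<Rightarrow> ('i weight \<Rightarrow> 'i weight) \<Rightarrow> 'i series \<Rightarrow> 'i series" where
  "Theta_w i w f = (\<lambda>m'. \<Sum>m | f m \<noteq> 0 \<and> Theta_monomial i w m m' \<noteq> 0.
                             f m * Theta_monomial i w m m')"

text \<open>The component at \<open>v = w s\<^sub>i\<close> comes from \<open>w = v s\<^sub>i\<close>.\<close>

definition Theta :: "'i \<Rightarrow> (('i weight \<Rightarrow> 'i weight) \<Rightarrow> 'i series)
                        \<Rightarrow> ('i weight \<Rightarrow> 'i weight) \<Rightarrow> 'i series" where
  "Theta i F = (\<lambda>v\<in>weyl. Theta_w i (v \<circ> refl i) (F (v \<circ> refl i)))"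

definition adm :: "(('i weight \<Rightarrow> 'i weight) \<Rightarrow> 'i series) set
                 \<Rightarrow> (('i weight \<Rightarrow> 'i weight) \<Rightarrow> 'i series) set" where
  "adm G = {g \<in> G. \<forall>w\<in>weyl. \<exists>\<alpha>\<in>\<Delta>. varpi (g w) = a_root \<alpha>}"

text \<open>The conditions that characterize the family \<open>f\<^sub>g\<^sub>,\<^sub>r\<close> for admissible \<open>g\<close> and \<open>r \<noteq> 0\<close>.\<close>

definition is_f_family ::
  "(('i weight \<Rightarrow> 'i weight) \<Rightarrow> 'i series) \<Rightarrow> int
     \<Rightarrow> (cstar \<Rightarrow> ('i weight \<Rightarrow> 'i weight) \<Rightarrow> 'i series) \<Rightarrow> bool" where
  "is_f_family g r F \<longleftrightarrow>
     (\<forall>a. F a \<in> Units Pi_ring) \<and>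
     (\<forall>a b. tau b (F a) = F (a * b)) \<and>
     (\<forall>a. F a = \<one>\<^bsub>Pi_ring\<^esub> \<oplus>\<^bsub>Pi_ring\<^esub> tau a g \<otimes>\<^bsub>Pi_ring\<^esub> F (a * q powi (- r)))"

definition f_elements :: "(('i weight \<Rightarrow> 'i weight) \<Rightarrow> 'i series) set
                        \<Rightarrow> (('i weight \<Rightarrow> 'i weight) \<Rightarrow> 'i series) set" where
  "f_elements G = {F a | F a. \<exists>g\<in>adm G. \<exists>r. r \<noteq> 0 \<and> is_f_family g r F}"

primrec G_level :: "nat \<Rightarrow> (('i weight \<Rightarrow> 'i weight) \<Rightarrow> 'i series) set" where
  "G_level 0 = range (\<lambda>m. diag (mono_series m))"
| "G_level (Suc k) = generate (units_of Pi_ring) (G_level k \<union> f_elements (G_level k))"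

primrec Y_level :: "nat \<Rightarrow> (('i weight \<Rightarrow> 'i weight) \<Rightarrow> 'i series) set" where
  "Y_level 0 = diag ` {f. finite {m. f m \<noteq> 0}}"
| "Y_level (Suc k) = generate_ring Pi_ring
     (Y_level k \<union> f_elements (G_level k) \<union> (\<lambda>x. inv\<^bsub>Pi_ring\<^esub> x) ` f_elements (G_level k))"

definition Y_bar :: "(('i weight \<Rightarrow> 'i weight) \<Rightarrow> 'i series) set" where
  "Y_bar = (\<Union>k. Y_level k)"

definition M_bar :: "(('i weight \<Rightarrow> 'i weight) \<Rightarrow> 'i series) set" where
  "M_bar = generate (units_of (Pi_ring\<lparr>carrier := Y_bar\<rparr>))
             (range (\<lambda>m. diag (mono_series m)) \<union> (\<Union>k. G_level k))"

text \<open>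
  \<open>\<int>[[A\<^sub>j\<^sub>,\<^sub>b\<^sup>-\<^sup>1]]\<close> as a subset of \<open>Ytilde id\<close>. The \<open>A\<^sub>j\<^sub>,\<^sub>b\<close> are multiplicatively independent, so that the
  constant term is the coefficient at the trivial monomial \<open>0\<close>.
\<close>

definition A_inv_monomials :: "'i monomial set" where
  "A_inv_monomials = {- (\<Sum>(j, b)\<in>Poly_Mapping.keys v.
       \<Sum>_<Poly_Mapping.lookup v (j, b). A j b) | v :: ('i \<times> cstar) \<Rightarrow>\<^sub>0 nat. True}"

definition A_inv_series :: "'i series set" where
  "A_inv_series = {f \<in> carrier (Ytilde id). \<forall>m. f m \<noteq> 0 \<longrightarrow> m \<in> A_inv_monomials}"

definition Lambda :: "(('i weight \<Rightarrow> 'i weight) \<Rightarrow> 'i series) \<Rightarrow> 'i monomial" where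
  "Lambda = (\<lambda>P\<in>M_bar. THE m. \<exists>S\<in>A_inv_series. (S 0 = 1 \<or> S 0 = -1) \<and>
                            P id = mono_series m \<otimes>\<^bsub>Ytilde id\<^esub> S)"

end

end

theory Submission
  imports Defs
begin

text \<open>
  The series \<open>\<Sigma>\<^sub>i\<^sub>,\<^sub>a\<close> satisfies \<open>\<Sigma>\<^sub>i\<^sub>,\<^sub>a = 1 + A\<^sub>i\<^sub>,\<^sub>a\<^sup>-\<^sup>1 \<Sigma>\<^sub>i\<^sub>,\<^sub>b\<close> with \<open>b = a q\<^sub>i\<^sup>-\<^sup>2\<close>, in each of its two expansions.
  It is therefore the family \<open>f\<^sub>g\<^sub>,\<^sub>r\<close> for \<open>g = A\<^sub>i\<^sub>,\<^sub>1\<^sup>-\<^sup>1\<close> and \<open>r = 2 d\<^sub>i\<close>, which is admissible because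
  \<open>- \<alpha>\<^sub>i\<close> is a root; so \<open>\<Theta>\<^sub>i\<close> maps monomials into \<open>G\<^sup>1\<close>. In the component at \<open>e\<close> the quotient of two
  such series is a series in the \<open>A\<^sub>j\<^sub>,\<^sub>b\<^sup>-\<^sup>1\<close> with constant term \<open>1\<close>, and only the monomial factor
  survives truncation. The factor is unique since a monomial and its inverse are both products of
  \<open>A\<^sub>j\<^sub>,\<^sub>b\<^sup>-\<^sup>1\<close> only if the weights, and hence all exponents, vanish. Up to the variables with \<open>j \<noteq> i\<close>, which
  it fixes, the resulting operator sends \<open>Y\<^sub>i\<^sub>,\<^sub>a\<close> to the inverse of \<open>Y\<^sub>i\<^sub>,\<^sub>b\<close>, so it is bijective.
\<close>

section \<open>Roots of a simple Lie algebra\<close>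

text \<open>The data are Chevalley generators, while the series need combinatorial facts about
  roots, and these are derived from simplicity. The definition of \<open>A\<close> recognises only
  the off-diagonal Cartan entries -1, -2, -3, so its weight is a simple root because no other
  negative entry occurs. Independence of the simple roots makes \<open>Q_plus\<close> a pointed cone
  with finite intervals; both the convolution of series and the uniqueness of the leading monomial
  rest on this. Stability of the roots under reflections, together with the dichotomy between
  positive and negative roots, ensures that for each \<open>w\<close> the expansion of \<Sigma>
  chosen by the sign of \<open>w \<alpha>\<^sub>i\<close> lies in \<open>Ytilde w\<close>. The
  images of monomials must be shown to lie in \<open>M_bar\<close>, since \<open>Lambda\<close> is
  unspecified outside that set. Finally, dividing by \<Sigma> requires control of the inverse series
  as well: grading by multiples of a single root gives an explicit recursion for it, from which its
  support can be read off.\<close>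

context cartan_setting
begin

lemma simple_root_nth [simp]: "simple_root i $ j = C $ j $ i"
  by (simp add: simple_root_def)

lemma Q_plus_iff:
  "\<mu> \<in> Q_plus \<longleftrightarrow> (\<exists>c :: 'i \<Rightarrow> nat. \<forall>j. \<mu> $ j = (\<Sum>i\<in>UNIV. int (c i) * C $ j $ i))"
  by (auto simp: Q_plus_def vec_eq_iff)

lemma Q_plus_zero [simp]: "0 \<in> Q_plus"
  unfolding Q_plus_iff by (intro exI[of _ "\<lambda>_. 0"]) simp

lemma Q_plus_add: "\<mu> \<in> Q_plus \<Longrightarrow> \<nu> \<in> Q_plus \<Longrightarrow> \<mu> + \<nu> \<in> Q_plus"
  unfolding Q_plus_iff
proof (elim exE)
  fix c c' :: "'i \<Rightarrow> nat"
  assume "\<forall>j. \<mu> $ j = (\<Sum>i\<in>UNIV. int (c i) * C $ j $ i)"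
    "\<forall>j. \<nu> $ j = (\<Sum>i\<in>UNIV. int (c' i) * C $ j $ i)"
  then show "\<exists>c :: 'i \<Rightarrow> nat. \<forall>j. (\<mu> + \<nu>) $ j = (\<Sum>i\<in>UNIV. int (c i) * C $ j $ i)"
    by (intro exI[of _ "\<lambda>i. c i + c' i"]) (simp add: algebra_simps sum.distrib)
qed

lemma simple_root_in_Q_plus: "simple_root i \<in> Q_plus"
  unfolding Q_plus_iff
  by (intro exI[of _ "\<lambda>j. of_bool (j = i)"]) (simp add: of_bool_def if_distrib if_distribR cong: if_cong)

lemma refl_nth [simp]: "refl i \<mu> $ j = \<mu> $ j - \<mu> $ i * C $ j $ i"
  by (simp add: refl_def)

end

section \<open>The bracket and its sl_2 strings\<close>

context simple_lie_algebra
begin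

lemma br_add_right: "br x (y + z) = br x y + br x z"
  by (rule module_hom.add[OF Vector_Spaces.linear.axioms(3)[OF br_linear_right]])

lemma br_add_left: "br (x + y) z = br x z + br y z"
  by (rule module_hom.add[OF Vector_Spaces.linear.axioms(3)[OF br_linear_left]])

lemma br_scale_right: "br x (sc c y) = sc c (br x y)"
  by (rule module_hom.scale[OF Vector_Spaces.linear.axioms(3)[OF br_linear_right]])

lemma br_scale_left: "br (sc c x) y = sc c (br x y)"
  by (rule module_hom.scale[OF Vector_Spaces.linear.axioms(3)[OF br_linear_left]])

lemma br_zero_right [simp]: "br x 0 = 0"
  by (rule module_hom.zero[OF Vector_Spaces.linear.axioms(3)[OF br_linear_right]])

lemma br_zero_left [simp]: "br 0 x = 0"
  by (rule module_hom.zero[OF Vector_Spaces.linear.axioms(3)[OF br_linear_left]])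

lemma br_minus_right: "br x (- y) = - br x y"
  by (rule module_hom.neg[OF Vector_Spaces.linear.axioms(3)[OF br_linear_right]])

lemma br_minus_left: "br (- x) y = - br x y"
  by (rule module_hom.neg[OF Vector_Spaces.linear.axioms(3)[OF br_linear_left]])

lemma br_sum_right: "br x (\<Sum>a\<in>S. g a) = (\<Sum>a\<in>S. br x (g a))"
  by (rule module_hom.sum[OF Vector_Spaces.linear.axioms(3)[OF br_linear_right]])

lemma br_sum_left: "br (\<Sum>a\<in>S. g a) x = (\<Sum>a\<in>S. br (g a) x)"
  by (rule module_hom.sum[OF Vector_Spaces.linear.axioms(3)[OF br_linear_left]])

lemma br_antisym: "br x y = - br y x"
proof -
  have "br (x + y) (x + y) = 0" by (rule br_self)
  then have "br x y + br y x = 0"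
    by (simp add: br_add_left br_add_right br_self[of x] br_self[of y] add.commute)
  then show ?thesis by (simp only: eq_neg_iff_add_eq_0 add.commute)
qed

lemma br_derivation: "br x (br y z) = br (br x y) z + br y (br x z)"
proof -
  have "br x (br y z) + br y (br z x) + br z (br x y) = 0" by (rule br_jacobi)
  moreover have "br y (br z x) = - br y (br x z)"
    by (subst br_antisym[of z x]) (rule br_minus_right)
  moreover have "br z (br x y) = - br (br x y) z" by (rule br_antisym)
  ultimately show ?thesis by (simp add: algebra_simps)
qed

lemma subspace_br_stable: "subspace {x. \<forall>y\<in>S. br x y \<in> S}" if "subspace S" for S
  by (rule subspaceI)
    (auto simp: br_add_left br_scale_left
      intro: subspace_add[OF that] subspace_scale[OF that] subspace_0[OF that])

lemma br_in_span:
  assumes "y \<in> span B" and "\<And>b. b \<in> B \<Longrightarrow> br x b \<in> span S"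
  shows "br x y \<in> span S"
  using assms(1)
proof (induction rule: span_induct_alt)
  case base
  then show ?case by (simp add: span_zero)
next
  case (step c b y)
  then show ?case
    using assms(2) by (auto simp: br_add_right br_scale_right intro!: span_add span_scale)
qed

text \<open>The vector \<open>y = E^p x\<close> at the top of the string has weight
  \<open>L = k + 2 p\<close>, and the vectors \<open>F^j y\<close> with \<open>j \<le> L\<close>
  cannot vanish. The exponent \<open>k + p \<le> L\<close> reaches weight \<open>- k\<close>, the
  mirror image of the weight of \<open>x\<close>; this is the source of the reflection symmetry of
  the weights.\<close>

lemma sl2_string:
  assumes EF: "br E F = H" and HE: "br H E = sc 2 E" and HF: "br H F = sc (-2) F"
    and x0: "x \<noteq> 0" and Hx: "br H x = sc (of_nat k) x" and nil: "(br E ^^ N) x = 0"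
  obtains p where "(br F ^^ (k + p)) ((br E ^^ p) x) \<noteq> 0"
proof -
  define p where "p = (LEAST n. (br E ^^ Suc n) x = 0)"
  have "N \<noteq> 0" using nil x0 by (cases N) auto
  then obtain n where "(br E ^^ Suc n) x = 0" using nil not0_implies_Suc by blast
  then have top: "(br E ^^ Suc p) x = 0"
    unfolding p_def by (rule LeastI)
  have ne: "(br E ^^ p) x \<noteq> 0"
  proof (cases p)
    case 0
    then show ?thesis using x0 by simp
  next
    case (Suc r)
    then have "\<not> (br E ^^ Suc r) x = 0"
      unfolding p_def by (intro not_less_Least) simp
    then show ?thesis unfolding Suc .
  qed
  define y where "y = (br E ^^ p) x"
  define L where "L = k + 2 * p"
  have HEp: "br H ((br E ^^ n) x) = sc (of_nat k + 2 * of_nat n) ((br E ^^ n) x)" for n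
  proof (induction n)
    case (Suc n)
    have "br H ((br E ^^ Suc n) x) = sc 2 ((br E ^^ Suc n) x) + br E (br H ((br E ^^ n) x))"
      by (simp add: br_derivation[of H E] HE br_scale_left)
    also have "\<dots> = sc (2 + (of_nat k + 2 * of_nat n)) ((br E ^^ Suc n) x)"
      by (simp add: Suc br_scale_right scale_left_distrib br_add_right)
    finally show ?case by (simp add: add_ac)
  qed (simp add: Hx)
  have Hy: "br H y = sc (of_nat L) y"
    using HEp[of p] by (simp add: y_def L_def)
  have HFj: "br H ((br F ^^ j) y) = sc (of_nat L - 2 * of_nat j) ((br F ^^ j) y)" for j
  proof (induction j)
    case (Suc j)
    have "br H ((br F ^^ Suc j) y) = sc (- 2) ((br F ^^ Suc j) y) + br F (br H ((br F ^^ j) y))"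
      by (simp add: br_derivation[of H F] HF br_scale_left br_minus_left)
    also have "\<dots> = sc (- 2 + (of_nat L - 2 * of_nat j)) ((br F ^^ Suc j) y)"
      by (simp only: Suc br_scale_right scale_left_distrib[symmetric] funpow.simps o_apply)
    finally show ?case by (simp add: algebra_simps)
  qed (simp add: Hy)
  \<comment> \<open>The coefficient \<open>(j + 1) (L - j)\<close> is nonzero for
    \<open>j < L\<close>, so down to position \<open>L\<close> each step of \<open>F\<close> is
    undone by \<open>E\<close> up to a nonzero scalar.\<close>
  have EFj: "br E ((br F ^^ Suc j) y)
      = sc (of_nat (Suc j) * (of_nat L - of_nat j)) ((br F ^^ j) y)" for j
  proof (induction j)
    case 0
    then show ?case using top HFj[of 0]
      by (simp add: br_derivation[of E F] EF y_def)
  next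
    case (Suc j)
    have "br E ((br F ^^ Suc (Suc j)) y)
        = br H ((br F ^^ Suc j) y) + br F (br E ((br F ^^ Suc j) y))"
      by (simp add: br_derivation[of E F] EF)
    also have "\<dots> = sc (of_nat L - 2 * of_nat (Suc j)) ((br F ^^ Suc j) y)
        + sc (of_nat (Suc j) * (of_nat L - of_nat j)) ((br F ^^ Suc j) y)"
      unfolding HFj[of "Suc j"] Suc.IH br_scale_right by simp
    also have "\<dots> = sc (of_nat (Suc (Suc j)) * (of_nat L - of_nat (Suc j))) ((br F ^^ Suc j) y)"
      unfolding scale_left_distrib[symmetric]
      by (rule arg_cong[of _ _ "\<lambda>c. sc c _"]) (simp add: algebra_simps)
    finally show ?case .
  qed
  have "j \<le> L \<Longrightarrow> (br F ^^ j) y \<noteq> 0" for j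
  proof (induction j)
    case 0
    then show ?case using ne by (simp add: y_def)
  next
    case (Suc j)
    have "of_nat L - of_nat j \<noteq> (0::complex)"
      using Suc.prems by (metis Suc_n_not_le_n eq_iff_diff_eq_0 of_nat_eq_iff)
    moreover have "of_nat (Suc j) \<noteq> (0::complex)" using of_nat_eq_0_iff by blast
    ultimately have "br E ((br F ^^ Suc j) y) \<noteq> 0"
      using Suc unfolding EFj by (auto simp del: of_nat_Suc)
    then show ?case by auto
  qed
  then have "(br F ^^ (k + p)) y \<noteq> 0" by (simp add: L_def)
  then show thesis using that by (simp add: y_def)
qed

end

text \<open>Applied to \<open>e\<close> and to \<open>f\<close>, these right-normed brackets span
  the positive and the negative part of the algebra. The right-normed form makes stability under the
  adjoint action of the generators an introduction rule.\<close>

inductive_set iterated_brackets :: "('g \<Rightarrow> 'g \<Rightarrow> 'g) \<Rightarrow> ('i \<Rightarrow> 'g) \<Rightarrow> 'g set"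
  for br :: "'g \<Rightarrow> 'g \<Rightarrow> 'g" and e :: "'i \<Rightarrow> 'g" where
  "e i \<in> iterated_brackets br e"
| "x \<in> iterated_brackets br e \<Longrightarrow> br (e i) x \<in> iterated_brackets br e"

section \<open>Weight vectors and the triangular decomposition\<close>

context simple_lie_algebra_cartan
begin

abbreviation "sroot \<equiv> cartan_setting.simple_root C"

declare cartan_setting.simple_root_nth [simp]

definition wvec :: "'i weight \<Rightarrow> 'g \<Rightarrow> bool" where
  "wvec \<mu> x \<longleftrightarrow> (\<forall>i. br (h i) x = sc (of_int (\<mu> $ i)) x)"

text \<open>The Chevalley involution at the level of generators: no automorphism of the algebra has
  to be constructed, and each fact about \<open>e\<close> becomes one about \<open>f\<close>, with
  weights negated.\<close>

lemma swap: "simple_lie_algebra_cartan sc br C (\<lambda>i. - h i) f e"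
proof (unfold_locales, goal_cases)
  case 4
  then show ?case using h_independent(1) by (auto simp: inj_def)
next
  case 5
  have "range (\<lambda>i. - h i) = uminus ` range h" by auto
  moreover have "independent (uminus ` range h)"
    unfolding independent_explicit_finite_subsets
  proof (intro allI impI ballI)
    fix S u v
    assume S: "S \<subseteq> uminus ` range h" "finite S" and sum0: "(\<Sum>v\<in>S. sc (u v) v) = 0" and v: "v \<in> S"
    have "(\<Sum>x\<in>uminus ` S. sc (u (- x)) x) = (\<Sum>v\<in>S. sc (u v) (- v))"
      by (subst sum.reindex) (auto simp: inj_on_def)
    also have "\<dots> = 0" using sum0 by (simp add: sum_negf)
    finally have "u (- (- v)) = 0"
      using h_independent(2)[unfolded independent_explicit_finite_subsets, rule_format,
          of "uminus ` S" "\<lambda>x. u (- x)" "- v"] S v by fastforce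
    then show "u v = 0" by simp
  qed
  ultimately show ?case by simp
next
  case (9 i j)
  then show ?case using br_e_f[of j i] br_antisym[of "f i" "e j"] by auto
qed (auto simp: C_diag C_offdiag C_zero br_minus_left br_minus_right br_h_h br_h_e br_h_f generated)


lemma wvec_br: "wvec \<mu> x \<Longrightarrow> wvec \<nu> y \<Longrightarrow> wvec (\<mu> + \<nu>) (br x y)"
  by (simp add: wvec_def br_derivation[of "h _"] br_scale_left br_scale_right scale_left_distrib)

lemma wvec_e: "wvec (sroot i) (e i)"
  by (simp add: wvec_def br_h_e)

lemma wvec_f: "wvec (- sroot i) (f i)"
  by (simp add: wvec_def br_h_f)

lemma wvec_zero [simp]: "wvec \<mu> 0"
  by (simp add: wvec_def)

lemma wvec_add: "wvec \<mu> x \<Longrightarrow> wvec \<mu> y \<Longrightarrow> wvec \<mu> (x + y)"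
  by (simp add: wvec_def br_add_right scale_right_distrib)

lemma wvec_scale: "wvec \<mu> x \<Longrightarrow> wvec \<mu> (sc c x)"
  by (simp add: wvec_def br_scale_right mult.commute)

lemma h_nonzero: "h i \<noteq> 0"
  using h_independent(2) dependent_zero by (metis rangeI)

lemma e_nonzero: "e i \<noteq> 0" and f_nonzero: "f i \<noteq> 0"
  using br_e_f[of i i] h_nonzero[of i] by auto

lemma h_coeffs_zero:
  assumes "(\<Sum>i\<in>UNIV. sc (b i) (h i)) = 0"
  shows "b i = 0"
proof -
  have "(\<Sum>v\<in>range h. sc (b (inv_into UNIV h v)) v) = 0"
    using assms by (subst sum.reindex) (auto simp: h_independent(1))
  then have "b (inv_into UNIV h (h i)) = 0"
    using h_independent(2)[unfolded independent_explicit_finite_subsets, rule_format,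
        of "range h" "\<lambda>v. b (inv_into UNIV h v)" "h i"] by simp
  then show ?thesis by (simp add: h_independent(1))
qed

text \<open>Eigenspaces for different eigenvalues are independent. If \<open>i\<close> is a
  coordinate separating \<open>\<nu>\<close> from the new weight \<open>\<mu>\<close>, applying
  \<open>br (h i)\<close> and subtracting \<open>\<mu> $ i\<close> times the sum removes
  \<open>x \<mu>\<close> and multiplies each remaining vector by a scalar, which is nonzero at
  \<open>\<nu>\<close>; the induction hypothesis applies to the rescaled vectors.\<close>

lemma wvec_sum_zero:
  assumes "finite F" "\<And>\<nu>. \<nu> \<in> F \<Longrightarrow> wvec \<nu> (x \<nu>)" "(\<Sum>\<nu>\<in>F. x \<nu>) = 0" "\<nu> \<in> F"
  shows "x \<nu> = 0"
  using assms
proof (induction F arbitrary: x \<nu> rule: finite_induct)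
  case (insert \<mu> F)
  have sum0: "(\<Sum>\<nu>\<in>F. x \<nu>) = - x \<mu>"
    using insert.prems(2) insert.hyps by (simp add: eq_neg_iff_add_eq_0 add.commute)
  have zero: "x \<nu> = 0" if "\<nu> \<in> F" for \<nu>
  proof -
    have "\<nu> \<noteq> \<mu>" using that insert.hyps by auto
    then obtain i where i: "\<nu> $ i \<noteq> \<mu> $ i" by (auto simp: vec_eq_iff)
    define y where "y \<equiv> \<lambda>\<nu>. sc (of_int (\<nu> $ i - \<mu> $ i)) (x \<nu>)"
    have "(\<Sum>\<nu>\<in>F. y \<nu>) = (\<Sum>\<nu>\<in>F. br (h i) (x \<nu>)) - (\<Sum>\<nu>\<in>F. sc (of_int (\<mu> $ i)) (x \<nu>))"
      using insert.prems(1)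
      by (simp add: y_def wvec_def scale_left_diff_distrib sum_subtractf)
    also have "\<dots> = br (h i) (- x \<mu>) - sc (of_int (\<mu> $ i)) (- x \<mu>)"
      by (simp only: sum0[symmetric] br_sum_right scale_sum_right)
    also have "\<dots> = 0"
      using insert.prems(1)[of \<mu>] by (simp add: wvec_def br_minus_right)
    finally have "y \<nu> = 0"
      using insert.IH[of y] insert.prems(1) that by (auto simp: y_def intro: wvec_scale)
    then show ?thesis using i by (simp add: y_def)
  qed
  then have "x \<mu> = 0" using sum0 by simp
  then show ?case using zero insert.prems(3) by auto
qed simp

text \<open>The weight 0 is kept, which avoids a case distinction in the string and reflection
  arguments; \<open>lie_roots_eq\<close> removes it again.\<close>

definition weights :: "'i weight set" where
  "weights = {\<mu>. \<exists>x. x \<noteq> 0 \<and> wvec \<mu> x}"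

lemma lie_roots_eq: "lie_roots sc br h = weights - {0}"
  by (auto simp: lie_roots_def weights_def wvec_def)

text \<open>One eigenvector is chosen for each weight. These are distinct and independent, so their
  number is bounded by the size of a finite spanning set.\<close>

lemma finite_weights: "finite weights"
proof -
  define v where "v \<mu> = (SOME x. x \<noteq> 0 \<and> wvec \<mu> x)" for \<mu>
  have v: "v \<mu> \<noteq> 0" "wvec \<mu> (v \<mu>)" if "\<mu> \<in> weights" for \<mu>
    using someI_ex[of "\<lambda>x. x \<noteq> 0 \<and> wvec \<mu> x"] that by (auto simp: weights_def v_def)
  have "inj_on v weights"
  proof (rule inj_onI, rule ccontr)
    fix \<mu> \<nu> assume \<mu>: "\<mu> \<in> weights" "\<nu> \<in> weights" "v \<mu> = v \<nu>" "\<mu> \<noteq> \<nu>"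
    then obtain i where "\<mu> $ i \<noteq> \<nu> $ i" by (auto simp: vec_eq_iff)
    moreover have "sc (of_int (\<mu> $ i)) (v \<mu>) = sc (of_int (\<nu> $ i)) (v \<mu>)"
      using v \<mu> by (metis wvec_def)
    ultimately show False using v \<mu> by simp
  qed
  moreover have "independent (v ` weights)"
    unfolding independent_explicit_finite_subsets
  proof (intro allI impI ballI)
    fix S u x
    assume S: "S \<subseteq> v ` weights" "finite S" and sum0: "(\<Sum>v\<in>S. sc (u v) v) = 0" and x: "x \<in> S"
    obtain F where F: "F \<subseteq> weights" "S = v ` F"
      using S(1) by (metis subset_image_iff)
    have inj: "inj_on v F" using \<open>inj_on v weights\<close> F(1) inj_on_subset by blast
    then have "finite F" using S(2) F(2) finite_imageD by blast
    obtain \<mu> where \<mu>: "\<mu> \<in> F" "x = v \<mu>" using x F(2) by auto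
    have "(\<Sum>\<mu>\<in>F. sc (u (v \<mu>)) (v \<mu>)) = 0"
      using sum0 unfolding F(2) by (simp add: sum.reindex[OF inj])
    then have "sc (u (v \<mu>)) (v \<mu>) = 0"
      using \<mu> F(1) v by (intro wvec_sum_zero[of F "\<lambda>\<mu>. sc (u (v \<mu>)) (v \<mu>)"])
        (auto intro: wvec_scale \<open>finite F\<close>)
    then show "u x = 0" using \<mu> F(1) v by auto
  qed
  moreover obtain B where "finite B" "span B = UNIV" using finite_dim by blast
  ultimately show ?thesis
    using independent_span_bound[of B "v ` weights"] finite_imageD by auto
qed

text \<open>Moving \<open>e j\<close> past \<open>f i\<close> produces \<open>h i\<close> or 0, and
  \<open>h i\<close> merely rescales the weight vector \<open>y\<close>. The remaining term is
  \<open>f i\<close> applied to a vector known by induction, and \<open>f i\<close> preserves the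
  span, since it maps each \<open>h k\<close> to a multiple of \<open>f i\<close>.\<close>

lemma e_on_negative:
  "y \<in> iterated_brackets br f \<Longrightarrow> br (e j) y \<in> span (range h \<union> iterated_brackets br f)"
    (is "_ \<Longrightarrow> _ \<in> span ?S")
proof (induction rule: iterated_brackets.induct)
  case (1 i)
  then show ?case by (auto simp: br_e_f intro: span_base span_zero)
next
  case (2 y i)
  have "\<exists>\<mu>. wvec \<mu> y"
    using 2(1) by induction (auto intro: wvec_f wvec_br)
  then have "br (h i) y \<in> span ?S"
    using 2(1) by (auto simp: wvec_def intro: span_scale[OF span_base])
  then have "br (br (e j) (f i)) y \<in> span ?S"
    by (simp add: br_e_f span_zero)
  moreover have "br (f i) (br (e j) y) \<in> span ?S"
  proof (rule br_in_span[OF 2(2)])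
    fix b assume "b \<in> ?S"
    then show "br (f i) b \<in> span ?S"
    proof
      assume "b \<in> range h"
      then obtain k where "b = h k" by auto
      then have "br (f i) b = sc (of_int (C $ k $ i)) (f i)"
        using br_antisym[of "f i" b] by (simp add: br_h_f)
      then show ?thesis by (auto intro: span_scale[OF span_base] iterated_brackets.intros)
    qed (auto intro!: span_base intro: iterated_brackets.intros)
  qed
  ultimately show ?case unfolding br_derivation[of "e j"] by (rule span_add)
qed

text \<open>The elements whose adjoint action preserves this span form a subalgebra \<open>N\<close>
  that contains all \<open>e j\<close> and \<open>f j\<close>, hence everything. So the span is a
  nonzero ideal, and simplicity finishes the proof.\<close>

lemma span_triangular: "span (range h \<union> iterated_brackets br e \<union> iterated_brackets br f) = UNIV"
  (is "span ?B = _")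
proof -
  have e_on_h: "br (e j) (h i) \<in> span ?B" for i j
    using br_antisym[of "e j" "h i"]
    by (auto simp: br_h_e scale_minus_left[symmetric] simp del: scale_minus_left
        intro: span_scale[OF span_base] iterated_brackets.intros)
  have f_on_h: "br (f j) (h i) \<in> span ?B" for i j
    using br_antisym[of "f j" "h i"]
    by (auto simp: br_h_f intro: span_scale[OF span_base] iterated_brackets.intros)
  have f_on_positive: "br (f j) y \<in> span ?B" if "y \<in> iterated_brackets br e" for j y
  proof -
    have "br (f j) y \<in> span (range (\<lambda>i. - h i) \<union> iterated_brackets br e)"
      using simple_lie_algebra_cartan.e_on_negative[OF swap that] .
    also have "\<dots> \<subseteq> span ?B"
      by (rule span_minimal) (auto intro: span_base span_neg)
    finally show ?thesis .
  qed
  have e_on_neg: "br (e j) y \<in> span ?B" if "y \<in> iterated_brackets br f" for j y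
    using e_on_negative[OF that] by (rule subsetD[OF span_mono, rotated]) auto
  define N where "N = {x. \<forall>y\<in>span ?B. br x y \<in> span ?B}"
  have gen: "x \<in> N" if "\<And>b. b \<in> ?B \<Longrightarrow> br x b \<in> span ?B" for x
    unfolding N_def by (intro CollectI ballI br_in_span[OF _ that])
  have "e j \<in> N" for j
  proof (rule gen)
    fix b assume "b \<in> ?B"
    then consider "b \<in> range h" | "b \<in> iterated_brackets br e" | "b \<in> iterated_brackets br f"
      by blast
    then show "br (e j) b \<in> span ?B"
      by cases (use e_on_h e_on_neg in \<open>auto intro: span_base iterated_brackets.intros(2)\<close>)
  qed
  moreover have "f j \<in> N" for j
  proof (rule gen)
    fix b assume "b \<in> ?B"
    then consider "b \<in> range h" | "b \<in> iterated_brackets br e" | "b \<in> iterated_brackets br f"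
      by blast
    then show "br (f j) b \<in> span ?B"
      by cases (use f_on_h f_on_positive in \<open>auto intro: span_base iterated_brackets.intros(2)\<close>)
  qed
  moreover have "br x y \<in> N" if "x \<in> N" "y \<in> N" for x y
    unfolding N_def
  proof (intro CollectI ballI)
    fix z assume z: "z \<in> span ?B"
    have "br (br x y) z = br x (br y z) - br y (br x z)"
      using br_derivation[of x y z] by simp
    also have "\<dots> \<in> span ?B"
      using that z by (intro span_diff) (simp_all add: N_def)
    finally show "br (br x y) z \<in> span ?B" .
  qed
  moreover have "subspace N" unfolding N_def by (rule subspace_br_stable) simp
  ultimately have N: "N = UNIV" by (intro generated) blast+
  have "span ?B = {0} \<or> span ?B = UNIV"
  proof (rule no_proper_ideal)
    show "br x y \<in> span ?B" if "y \<in> span ?B" for x y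
      using that N by (auto simp: N_def)
  qed simp
  moreover have "h undefined \<in> span ?B" by (rule span_base) blast
  ultimately show ?thesis using h_nonzero by (metis singletonD)
qed

end

section \<open>Signs of the weights, reflections, and bounds on the Cartan entries\<close>

context simple_lie_algebra_cartan
begin

abbreviation "Qp \<equiv> cartan_setting.Q_plus C"

lemma iterated_bracket_wvec:
  "x \<in> iterated_brackets br e \<Longrightarrow> \<exists>\<mu>\<in>Qp. wvec \<mu> x"
proof (induction rule: iterated_brackets.induct)
  case (1 i)
  then show ?case using wvec_e cartan_setting.simple_root_in_Q_plus by blast
next
  case (2 x i)
  then show ?case
    using wvec_br[OF wvec_e] cartan_setting.Q_plus_add[OF cartan_setting.simple_root_in_Q_plus] by blast
qed

lemma wvec_swap:
  "simple_lie_algebra_cartan.wvec sc br (\<lambda>i. - h i) \<mu> x \<longleftrightarrow> wvec (- \<mu>) x"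
  unfolding simple_lie_algebra_cartan.wvec_def[OF swap] wvec_def
  by (simp add: br_minus_left minus_equation_iff) (metis minus_minus)

lemma span_wvec_decomposition:
  assumes "x \<in> span B" "\<And>b. b \<in> B \<Longrightarrow> \<exists>\<mu>\<in>K. wvec \<mu> b"
  shows "\<exists>F g. finite F \<and> F \<subseteq> K \<and> (\<forall>\<nu>. wvec \<nu> (g \<nu>)) \<and> x = (\<Sum>\<nu>\<in>F. g \<nu>)"
  using assms(1)
proof (induction rule: span_induct_alt)
  case base
  then show ?case by (intro exI[of _ "{}"] exI[of _ "\<lambda>_. 0"]) simp
next
  case (step c b y)
  obtain F g where F: "finite F" "F \<subseteq> K" "\<forall>\<nu>. wvec \<nu> (g \<nu>)" "y = (\<Sum>\<nu>\<in>F. g \<nu>)"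
    using step(2) by blast
  obtain \<mu> where \<mu>: "\<mu> \<in> K" "wvec \<mu> b" using assms(2) step(1) by blast
  \<comment> \<open>One formula covers both the case that \<open>\<mu>\<close> already occurs in
    \<open>F\<close> and the case that it is new. Values of \<open>g\<close> outside
    \<open>F\<close> are discarded, as they do not belong to the sum for \<open>y\<close>.\<close>
  define g' where "g' \<nu> = (if \<nu> = \<mu> then sc c b else 0) + (if \<nu> \<in> F then g \<nu> else 0)" for \<nu>
  have "(\<Sum>\<nu>\<in>insert \<mu> F. g' \<nu>) = sc c b + (\<Sum>\<nu>\<in>insert \<mu> F. if \<nu> \<in> F then g \<nu> else 0)"
    unfolding g'_def using F(1) by (simp only: sum.distrib) simp
  also have "(\<Sum>\<nu>\<in>insert \<mu> F. if \<nu> \<in> F then g \<nu> else 0) = y"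
    unfolding F(4) using F(1) by (intro sum.mono_neutral_cong_right) auto
  finally show ?case using F \<mu>
    by (intro exI[of _ "insert \<mu> F"] exI[of _ g'])
      (auto simp: g'_def intro!: wvec_add wvec_scale)
qed

text \<open>By the triangular decomposition, \<open>x\<close> is a sum of weight vectors with
  weights in \<open>Qp\<close> or its negative. If \<open>\<mu>\<close> is none of these, inserting
  \<open>- x\<close> in the slot \<open>\<mu>\<close> gives a vanishing sum over distinct weights,
  which forces \<open>x = 0\<close>.\<close>

lemma weights_positive_or_negative:
  assumes "\<mu> \<in> weights"
  shows "\<mu> \<in> Qp \<or> - \<mu> \<in> Qp"
proof (rule ccontr)
  assume "\<not> ?thesis"
  then have notin: "\<mu> \<notin> Qp \<union> uminus ` Qp" by auto
  obtain x where x: "x \<noteq> 0" "wvec \<mu> x" using assms by (auto simp: weights_def)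
  have "\<exists>\<nu>\<in>Qp \<union> uminus ` Qp. wvec \<nu> b"
    if "b \<in> range h \<union> iterated_brackets br e \<union> iterated_brackets br f" for b
    using that
  proof (elim UnE)
    assume "b \<in> range h"
    then have "wvec 0 b" by (auto simp: wvec_def br_h_h)
    then show ?thesis using cartan_setting.Q_plus_zero[of C] by blast
  next
    assume "b \<in> iterated_brackets br e"
    then show ?thesis using iterated_bracket_wvec by blast
  next
    assume "b \<in> iterated_brackets br f"
    then show ?thesis
      using simple_lie_algebra_cartan.iterated_bracket_wvec[OF swap] wvec_swap by blast
  qed
  then obtain F g where F: "finite F" "F \<subseteq> Qp \<union> uminus ` Qp" "\<forall>\<nu>. wvec \<nu> (g \<nu>)"
      "x = (\<Sum>\<nu>\<in>F. g \<nu>)"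
    using span_wvec_decomposition[of x] span_triangular by (metis UNIV_I)
  have "\<mu> \<notin> F" using notin F(2) by blast
  define g' where "g' = g(\<mu> := - x)"
  have "(\<Sum>\<nu>\<in>F. g' \<nu>) = (\<Sum>\<nu>\<in>F. g \<nu>)"
    using \<open>\<mu> \<notin> F\<close> by (intro sum.cong) (auto simp: g'_def)
  then have "(\<Sum>\<nu>\<in>insert \<mu> F. g' \<nu>) = 0"
    using F(1,4) \<open>\<mu> \<notin> F\<close> by (simp add: g'_def)
  moreover have "wvec \<nu> (g' \<nu>)" for \<nu>
    using F(3) wvec_scale[OF x(2), of "-1"] by (auto simp: g'_def)
  ultimately have "g' \<mu> = 0"
    using F(1) by (intro wvec_sum_zero[of "insert \<mu> F" g']) auto
  then show False using x(1) by (simp add: g'_def)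
qed

lemma wvec_e_power: "wvec \<mu> x \<Longrightarrow> wvec (\<mu> + (\<chi> j. int n * C $ j $ i)) ((br (e i) ^^ n) x)"
proof (induction n)
  case 0
  have "(\<chi> j. int 0 * C $ j $ i) = 0" by (simp add: vec_eq_iff)
  with 0 show ?case by simp
next
  case (Suc n)
  have "sroot i + (\<mu> + (\<chi> j. int n * C $ j $ i)) = \<mu> + (\<chi> j. int (Suc n) * C $ j $ i)"
    by (simp add: vec_eq_iff algebra_simps)
  then show ?case using wvec_br[OF wvec_e Suc.IH[OF Suc.prems], of i]
    by (simp only: funpow.simps o_apply)
qed

lemma wvec_f_power: "wvec \<mu> x \<Longrightarrow> wvec (\<mu> - (\<chi> j. int n * C $ j $ i)) ((br (f i) ^^ n) x)"
proof (induction n)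
  case 0
  have "(\<chi> j. int 0 * C $ j $ i) = 0" by (simp add: vec_eq_iff)
  with 0 show ?case by simp
next
  case (Suc n)
  have "- sroot i + (\<mu> - (\<chi> j. int n * C $ j $ i)) = \<mu> - (\<chi> j. int (Suc n) * C $ j $ i)"
    by (simp add: vec_eq_iff algebra_simps)
  then show ?case using wvec_br[OF wvec_f Suc.IH[OF Suc.prems], of i]
    by (simp only: funpow.simps o_apply)
qed

text \<open>Otherwise all \<open>\<mu> + n \<alpha>\<^sub>i\<close> would be weights. They are
  distinct, as coordinate \<open>i\<close> grows by \<open>2 n\<close>, whereas there are only
  finitely many weights.\<close>

lemma e_locally_nilpotent:
  assumes "wvec \<mu> x"
  shows "\<exists>N. (br (e i) ^^ N) x = 0"
proof (rule ccontr)
  assume "\<not> ?thesis"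
  then have "\<mu> + (\<chi> j. int n * C $ j $ i) \<in> weights" for n
    using wvec_e_power[OF assms] by (auto simp: weights_def)
  then have "range (\<lambda>n. \<mu> + (\<chi> j. int n * C $ j $ i)) \<subseteq> weights" by auto
  moreover have "inj (\<lambda>n. \<mu> + (\<chi> j. int n * C $ j $ i))"
  proof (rule injI)
    fix m n :: nat
    assume "\<mu> + (\<chi> j. int m * C $ j $ i) = \<mu> + (\<chi> j. int n * C $ j $ i)"
    then have "(\<chi> j. int m * C $ j $ i) $ i = (\<chi> j. int n * C $ j $ i) $ i" by simp
    then show "m = n" by (simp add: C_diag)
  qed
  ultimately show False
    using finite_weights by (meson finite_imageD finite_subset infinite_UNIV_nat)
qed

text \<open>The string runs \<open>p\<close> steps up and \<open>k + p\<close> steps down, where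
  \<open>k\<close> is coordinate \<open>i\<close> of \<open>\<mu>\<close>. The nonzero vector
  obtained has weight \<open>\<mu> - k \<alpha>\<^sub>i\<close>, which is the reflected
  weight.\<close>

lemma weights_refl_nonneg:
  assumes "\<mu> \<in> weights" "\<mu> $ i \<ge> 0"
  shows "cartan_setting.refl C i \<mu> \<in> weights"
proof -
  obtain x where x: "x \<noteq> 0" "wvec \<mu> x" using assms by (auto simp: weights_def)
  define k where "k = nat (\<mu> $ i)"
  have k: "\<mu> $ i = int k" using assms(2) by (simp add: k_def)
  obtain N where N: "(br (e i) ^^ N) x = 0" using e_locally_nilpotent[OF x(2)] by blast
  have Hx: "br (h i) x = sc (of_nat k) x" using x(2) k by (simp add: wvec_def)
  obtain p where p: "(br (f i) ^^ (k + p)) ((br (e i) ^^ p) x) \<noteq> 0"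
    using sl2_string[of "e i" "f i" "h i" x k N] x(1) Hx N
    by (auto simp: br_e_f br_h_e br_h_f C_diag)
  have "wvec (\<mu> + (\<chi> j. int p * C $ j $ i) - (\<chi> j. int (k + p) * C $ j $ i))
      ((br (f i) ^^ (k + p)) ((br (e i) ^^ p) x))"
    by (intro wvec_f_power wvec_e_power x(2))
  also have "\<mu> + (\<chi> j. int p * C $ j $ i) - (\<chi> j. int (k + p) * C $ j $ i)
      = cartan_setting.refl C i \<mu>"
    by (simp add: vec_eq_iff cartan_setting.refl_nth k algebra_simps)
  finally show ?thesis using p by (auto simp: weights_def)
qed

lemma weights_swap: "simple_lie_algebra_cartan.weights sc br (\<lambda>i. - h i) = uminus ` weights"
  unfolding simple_lie_algebra_cartan.weights_def[OF swap] weights_def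
  by (auto simp: wvec_swap image_iff) (metis minus_minus)+

lemma weights_refl:
  assumes "\<mu> \<in> weights"
  shows "cartan_setting.refl C i \<mu> \<in> weights"
proof (cases "\<mu> $ i \<ge> 0")
  case True
  then show ?thesis using weights_refl_nonneg assms by blast
next
  case False
  \<comment> \<open>For the swapped generators the weights are negated, so the negative coordinate
    becomes positive and the previous case applies.\<close>
  then have "cartan_setting.refl C i (- \<mu>) \<in> uminus ` weights"
    using simple_lie_algebra_cartan.weights_refl_nonneg[OF swap, of "- \<mu>" i] assms
    by (simp add: weights_swap)
  moreover have "cartan_setting.refl C i (- \<mu>) = - cartan_setting.refl C i \<mu>"
    by (simp add: vec_eq_iff cartan_setting.refl_nth)
  ultimately show ?thesis by auto
qed

lemma roots_refl:
  assumes "\<alpha> \<in> lie_roots sc br h"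
  shows "cartan_setting.refl C i \<alpha> \<in> lie_roots sc br h"
proof -
  have "cartan_setting.refl C i \<alpha> \<noteq> 0"
  proof
    assume 0: "cartan_setting.refl C i \<alpha> = 0"
    then have *: "\<alpha> $ j - \<alpha> $ i * C $ j $ i = 0" for j
      by (simp only: 0 cartan_setting.refl_nth[symmetric] zero_index)
    have ai: "\<alpha> $ i = 0" using *[of i] by (simp add: C_diag)
    have "\<alpha> $ j = 0" for j using *[of j] unfolding ai by simp
    then have "\<alpha> = 0" by (simp add: vec_eq_iff)
    then show False using assms by (simp add: lie_roots_def)
  qed
  then show ?thesis using assms weights_refl by (simp add: lie_roots_eq)
qed

lemma sroot_is_root: "sroot i \<in> lie_roots sc br h"
  and minus_sroot_is_root: "- sroot i \<in> lie_roots sc br h"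
proof -
  have "sroot i \<noteq> 0" using C_diag[of i] by (auto simp: vec_eq_iff intro!: exI[of _ i])
  then show "sroot i \<in> lie_roots sc br h" "- sroot i \<in> lie_roots sc br h"
    unfolding lie_roots_eq weights_def
    using wvec_e[of i] wvec_f[of i] e_nonzero[of i] f_nonzero[of i] by auto
qed

text \<open>The elements commuting with \<open>z\<close> form a subalgebra, so commuting with the
  generators makes \<open>z\<close> central. The centre is an ideal, and it is not everything
  because the bracket is not identically zero.\<close>

lemma central_zero:
  assumes "\<And>i. br z (e i) = 0" "\<And>i. br z (f i) = 0"
  shows "z = 0"
proof -
  have "{y. br z y = 0} = UNIV"
  proof (rule generated)
    show "subspace {y. br z y = 0}"
      by (rule subspaceI) (auto simp: br_add_right br_scale_right)
    show "br x y \<in> {y. br z y = 0}" if "x \<in> {y. br z y = 0}" "y \<in> {y. br z y = 0}" for x y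
      using that by (simp add: br_derivation[of z])
  qed (use assms in auto)
  then have z: "br z y = 0" for y by auto
  define Z where "Z = {z. \<forall>y. br z y = 0}"
  have "Z = {0} \<or> Z = UNIV"
  proof (rule no_proper_ideal)
    show "subspace Z"
      unfolding Z_def by (rule subspaceI) (auto simp: br_add_left br_scale_left)
    show "br x y \<in> Z" if "y \<in> Z" for x y
      using that br_antisym[of x y] by (auto simp: Z_def)
  qed
  moreover have "Z \<noteq> UNIV" using not_abelian by (auto simp: Z_def)
  ultimately show ?thesis using z by (auto simp: Z_def)
qed

text \<open>The factors \<open>d i\<close> turn a relation between the columns of \<open>C\<close>
  into one between its rows. This relation says that the element \<open>z\<close> of the Cartan
  subalgebra commutes with every \<open>e j\<close> and \<open>f j\<close>; hence
  \<open>z = 0\<close>, and independence of the \<open>h i\<close> gives the claim.\<close>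

lemma simple_roots_independent:
  assumes "is_symmetrizer C d" and "\<And>j. (\<Sum>i\<in>UNIV. c i * C $ j $ i) = 0"
  shows "c i = 0"
proof -
  have d: "d j > 0" "int (d j) * C $ j $ k = int (d k) * C $ k $ j" for j k
    using assms(1) by (auto simp: is_symmetrizer_def)
  define z where "z = (\<Sum>i\<in>UNIV. sc (of_int (c i * int (d i))) (h i))"
  have col: "(\<Sum>i\<in>UNIV. c i * int (d i) * C $ i $ j) = 0" for j
  proof -
    have "(\<Sum>i\<in>UNIV. c i * int (d i) * C $ i $ j) = int (d j) * (\<Sum>i\<in>UNIV. c i * C $ j $ i)"
      unfolding sum_distrib_left using d(2) by (intro sum.cong) (auto simp: mult_ac)
    then show ?thesis using assms(2) by simp
  qed
  have "br z (e j) = sc (of_int (\<Sum>i\<in>UNIV. c i * int (d i) * C $ i $ j)) (e j)" for j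
    unfolding z_def br_sum_left br_scale_left br_h_e by (simp add: scale_sum_left)
  then have 1: "br z (e j) = 0" for j by (simp add: col del: of_int_sum)
  have "br z (f j) = - sc (of_int (\<Sum>i\<in>UNIV. c i * int (d i) * C $ i $ j)) (f j)" for j
    unfolding z_def br_sum_left br_scale_left br_h_f by (simp add: scale_sum_left sum_negf)
  then have 2: "br z (f j) = 0" for j by (simp add: col del: of_int_sum)
  have "z = 0" using central_zero[of z] 1 2 by blast
  then have "of_int (c i * int (d i)) = (0 :: complex)"
    unfolding z_def by (rule h_coeffs_zero)
  then show ?thesis using d(1)[of i] by simp
qed

text \<open>
  If \<open>C\<^sub>i\<^sub>j C\<^sub>j\<^sub>i \<ge> 4\<close>, then alternating \<open>s\<^sub>i\<close> and \<open>s\<^sub>j\<close> makes the coefficients of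
  \<open>x \<alpha>\<^sub>i + y \<alpha>\<^sub>j\<close> grow forever, contradicting the finiteness of the set of roots.
\<close>

lemma cartan_entry_product_le_3:
  assumes sym: "is_symmetrizer C d" and ij: "i \<noteq> j"
  shows "C $ i $ j * C $ j $ i \<le> 3"
proof (rule ccontr)
  define a b where "a = - C $ i $ j" and "b = - C $ j $ i"
  assume "\<not> ?thesis"
  then have ab: "a * b \<ge> 4" by (simp add: a_def b_def)
  have nonneg: "a \<ge> 0" "b \<ge> 0" using C_offdiag ij by (auto simp: a_def b_def)
  then have pos: "a > 0" "b > 0" using ab by (auto simp: order.order_iff_strict)
  define v where "v = (\<lambda>(x, y). \<chi> l. x * C $ l $ i + y * C $ l $ j)"
  have refl_i: "cartan_setting.refl C i (v (x, y)) = v (a * y - x, y)" for x y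
    by (simp add: vec_eq_iff cartan_setting.refl_nth v_def C_diag a_def algebra_simps)
  have refl_j: "cartan_setting.refl C j (v (x, y)) = v (x, b * x - y)" for x y
    by (simp add: vec_eq_iff cartan_setting.refl_nth v_def C_diag b_def algebra_simps)
  have "inj v"
  proof (rule injI)
    fix p p' assume eq: "v p = v p'"
    obtain x y x' y' where p: "p = (x, y)" "p' = (x', y')" by (metis surj_pair)
    define c where "c l = (if l = i then x - x' else 0) + (if l = j then y - y' else 0)" for l
    have "(\<Sum>k\<in>UNIV. c k * C $ l $ k) = 0" for l
    proof -
      have "(\<Sum>k\<in>UNIV. c k * C $ l $ k) = (x - x') * C $ l $ i + (y - y') * C $ l $ j"
      proof -
        have "c k * C $ l $ k = (if k = i then (x - x') * C $ l $ i else 0)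
            + (if k = j then (y - y') * C $ l $ j else 0)" for k
          by (simp add: c_def distrib_right)
        then show ?thesis by (simp only: sum.distrib) simp
      qed
      moreover have "v p $ l = v p' $ l" using eq by simp
      ultimately show ?thesis by (simp add: v_def p algebra_simps)
    qed
    then have "c k = 0" for k using simple_roots_independent[OF sym] by blast
    then have "c i = 0" "c j = 0" by blast+
    then show "p = p'" using ij by (simp add: p c_def)
  qed
  \<comment> \<open>The condition \<open>a * y > 2 * x\<close> lets the process repeat: it gives
    \<open>2 * x' > a * y\<close>, and then \<open>a * b \<ge> 4\<close> yields both
    \<open>y' > y\<close> and \<open>a * y' > 2 * x'\<close>. The start is the root
    \<open>\<alpha>\<^sub>j\<close>, with coordinates 0 and 1.\<close>
  have grow: "\<exists>x y. v (x, y) \<in> weights \<and> y > int n \<and> a * y > 2 * x \<and> x \<ge> 0" for n :: nat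
  proof (induction n)
    case 0
    have "v (0, 1) = sroot j" by (simp add: v_def vec_eq_iff)
    then have "v (0, 1) \<in> weights" using sroot_is_root lie_roots_eq by auto
    then show ?case using pos by (intro exI[of _ 0] exI[of _ 1]) auto
  next
    case (Suc n)
    then obtain x y where xy: "v (x, y) \<in> weights" "y > int n" "a * y > 2 * x" "x \<ge> 0"
      by blast
    define x' where "x' = a * y - x"
    define y' where "y' = b * x' - y"
    have "v (x', y) \<in> weights" using weights_refl[OF xy(1), of i] by (simp add: refl_i x'_def)
    then have v': "v (x', y') \<in> weights"
      using weights_refl[of _ j] by (simp add: refl_j[symmetric] y'_def)
    have x': "2 * x' > a * y" "x' > 0" using xy by (auto simp: x'_def)
    have "4 * y \<le> a * b * y" using ab xy(2) by (intro mult_right_mono) auto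
    also have "\<dots> = b * (a * y)" by simp
    also have "\<dots> < b * (2 * x')" using x' pos by (intro mult_strict_left_mono) auto
    finally have y': "y' > y" by (simp add: y'_def)
    have "2 * (a * y') = 2 * (a * b * x') - 2 * (a * y)" by (simp add: y'_def algebra_simps)
    also have "\<dots> > 2 * (a * b * x') - 2 * (2 * x')" using x' by simp
    finally have "2 * (a * y') > 2 * (a * b * x') - 2 * (2 * x')" .
    moreover have "a * b * x' \<ge> 4 * x'" using ab x' by (intro mult_right_mono) auto
    ultimately have "a * y' > 2 * x'" by linarith
    then have "v (x', y') \<in> weights \<and> y' > int (Suc n) \<and> a * y' > 2 * x' \<and> x' \<ge> 0"
      using v' xy(2) x' y' by simp
    then show ?case by blast
  qed
  have "finite (v -` weights)" using finite_vimageI[OF finite_weights \<open>inj v\<close>] .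
  then have "finite (snd ` (v -` weights))" by simp
  then obtain N where N: "y \<le> N" if "y \<in> snd ` (v -` weights)" for y
    by (meson finite_has_maximal bdd_above_finite bdd_above_def)
  obtain x y where "v (x, y) \<in> weights" "y > int (nat N)" using grow by blast
  moreover have "y \<in> snd ` (v -` weights)"
    using \<open>v (x, y) \<in> weights\<close> by (intro image_eqI[of _ _ "(x, y)"]) auto
  ultimately show False using N[of y] by linarith
qed

text \<open>An off-diagonal entry and its transpose vanish together. Otherwise both are at most -1,
  so the absolute value of each is bounded by their product.\<close>

lemma cartan_entries:
  assumes "is_symmetrizer C d" "i \<noteq> j"
  shows "C $ i $ j \<in> {0, -1, -2, -3}"
proof (cases "C $ i $ j = 0")
  case False
  then have "C $ i $ j < 0" "C $ j $ i < 0"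
    using C_offdiag[of i j] C_offdiag[of j i] C_zero[of j i] assms(2) by (auto simp: order.order_iff_strict)
  then have "- C $ i $ j * 1 \<le> (- C $ i $ j) * (- C $ j $ i)"
    by (intro mult_left_mono) auto
  then have "- C $ i $ j \<le> 3" using cartan_entry_product_le_3[OF assms] by simp
  then show ?thesis using \<open>C $ i $ j < 0\<close> by auto
qed simp

end

section \<open>The completed rings\<close>

text \<open>The interface between the Lie algebra and the series: from here on the roots enter only
  through these combinatorial properties.\<close>

locale root_setting = cartan_setting C d q \<Delta>
  for C :: "int ^ 'i::finite ^ 'i" and d :: "'i \<Rightarrow> nat" and q :: cstar and \<Delta> :: "'i weight set" +
  assumes C_diag: "C $ i $ i = 2"
    and C_entries: "i \<noteq> j \<Longrightarrow> C $ i $ j \<in> {0, -1, -2, -3}"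
    and independent: "(\<And>j. (\<Sum>i\<in>UNIV. c i * C $ j $ i) = 0) \<Longrightarrow> c i = 0"
    and roots_refl: "\<alpha> \<in> \<Delta> \<Longrightarrow> refl i \<alpha> \<in> \<Delta>"
    and roots_sign: "\<alpha> \<in> \<Delta> \<Longrightarrow> \<alpha> \<in> Q_plus \<or> - \<alpha> \<in> Q_plus"
    and simple_root_in_roots: "simple_root i \<in> \<Delta>"
    and minus_simple_root_in_roots: "- simple_root i \<in> \<Delta>"
    and d_pos: "d i > 0"
begin

lemma refl_refl [simp]: "refl i (refl i \<mu>) = \<mu>"
  by (simp add: vec_eq_iff C_diag)

lemma refl_o_refl [simp]: "w \<circ> refl i \<circ> refl i = w"
  by (simp add: fun_eq_iff)

lemma refl_add: "refl i (\<mu> + \<nu>) = refl i \<mu> + refl i \<nu>"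
  by (simp add: vec_eq_iff algebra_simps)

lemma weyl_add: "w \<in> weyl \<Longrightarrow> w (\<mu> + \<nu>) = w \<mu> + w \<nu>"
  by (induction arbitrary: \<mu> \<nu> rule: weyl.induct) (simp_all add: refl_add)

lemma weyl_zero: "w \<in> weyl \<Longrightarrow> w 0 = 0"
  using weyl_add[of w 0 0] by simp

lemma weyl_minus: "w \<in> weyl \<Longrightarrow> w (- \<mu>) = - w \<mu>"
  using weyl_add[of w \<mu> "- \<mu>"] weyl_zero[of w] by (simp add: eq_neg_iff_add_eq_0 add.commute)

lemma weyl_diff: "w \<in> weyl \<Longrightarrow> w (\<mu> - \<nu>) = w \<mu> - w \<nu>"
  using weyl_add[of w \<mu> "- \<nu>"] weyl_minus[of w \<nu>] by simp

lemma weyl_inj: "w \<in> weyl \<Longrightarrow> inj w"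
proof (induction rule: weyl.induct)
  case (weyl_refl w i)
  have "inj (refl i)" by (rule inj_on_inverseI[of _ "refl i"]) simp
  with weyl_refl(2) show ?case by (rule inj_compose)
qed simp

lemma weyl_scale: "w \<in> weyl \<Longrightarrow> w (int n *s \<mu>) = int n *s w \<mu>"
proof (induction n)
  case (Suc n)
  have "int (Suc n) *s \<nu> = \<nu> + int n *s \<nu>" for \<nu> :: "'i weight"
    by (simp add: vec_eq_iff algebra_simps)
  then show ?case using Suc by (simp add: weyl_add)
qed (simp add: weyl_zero)

lemma weyl_roots: "w \<in> weyl \<Longrightarrow> \<alpha> \<in> \<Delta> \<Longrightarrow> w \<alpha> \<in> \<Delta>"
  by (induction arbitrary: \<alpha> rule: weyl.induct) (simp_all add: roots_refl)

lemma simple_root_nonzero: "simple_root i \<noteq> 0"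
  using C_diag[of i] by (auto simp: vec_eq_iff intro!: exI[of _ i])

lemma Q_plus_scale: "\<mu> \<in> Q_plus \<Longrightarrow> int n *s \<mu> \<in> Q_plus"
proof (induction n)
  case (Suc n)
  have "int (Suc n) *s \<mu> = \<mu> + int n *s \<mu>"
    by (simp add: vec_eq_iff algebra_simps)
  then show ?case using Suc by (simp add: Q_plus_add)
qed simp

text \<open>Coefficients with respect to the simple roots are unique, so those of
  \<open>\<beta>\<close> are bounded by those of \<open>\<nu>\<close>. This finiteness is what makes
  products of series well defined.\<close>

lemma finite_Q_plus_interval: "finite {\<beta> \<in> Q_plus. \<nu> - \<beta> \<in> Q_plus}"
proof (cases "\<nu> \<in> Q_plus")
  case False
  have "{\<beta> \<in> Q_plus. \<nu> - \<beta> \<in> Q_plus} = {}"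
    using False Q_plus_add[of _ "\<nu> - _"] by fastforce
  then show ?thesis by (simp only: finite.emptyI)
next
  case True
  then obtain n :: "'i \<Rightarrow> nat" where n: "\<And>j. \<nu> $ j = (\<Sum>i\<in>UNIV. int (n i) * C $ j $ i)"
    unfolding Q_plus_iff by blast
  define V where "V c = (\<chi> j. \<Sum>i\<in>UNIV. int (c i) * C $ j $ i)" for c :: "'i \<Rightarrow> nat"
  have "\<beta> \<in> V ` (\<Pi>\<^sub>E i\<in>UNIV. {..n i})" if \<beta>: "\<beta> \<in> Q_plus" "\<nu> - \<beta> \<in> Q_plus" for \<beta>
  proof -
    obtain b :: "'i \<Rightarrow> nat" where b: "\<And>j. \<beta> $ j = (\<Sum>i\<in>UNIV. int (b i) * C $ j $ i)"
      using \<beta>(1) unfolding Q_plus_iff by blast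
    obtain b' :: "'i \<Rightarrow> nat" where b': "\<And>j. (\<nu> - \<beta>) $ j = (\<Sum>i\<in>UNIV. int (b' i) * C $ j $ i)"
      using \<beta>(2) unfolding Q_plus_iff by blast
    have "(\<Sum>i\<in>UNIV. (int (b i) + int (b' i) - int (n i)) * C $ j $ i) = 0" for j
      using b[of j] b'[of j] n[of j] by (simp add: algebra_simps sum.distrib sum_subtractf)
    then have "int (b i) + int (b' i) - int (n i) = 0" for i by (rule independent)
    then have "b i + b' i = n i" for i by (metis eq_iff_diff_eq_0 of_nat_add of_nat_eq_iff)
    then have "b i \<le> n i" for i by (metis le_add1)
    moreover have "\<beta> = V b" by (simp add: V_def vec_eq_iff b)
    ultimately show ?thesis by auto
  qed
  moreover have "finite (V ` (\<Pi>\<^sub>E i\<in>UNIV. {..n i}))" by (intro finite_imageI finite_PiE) auto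
  ultimately show ?thesis by (rule_tac finite_subset) auto
qed

lemma Q_plus_pointed: "\<mu> \<in> Q_plus \<Longrightarrow> - \<mu> \<in> Q_plus \<Longrightarrow> \<mu> = 0"
proof -
  assume \<mu>: "\<mu> \<in> Q_plus" "- \<mu> \<in> Q_plus"
  obtain b :: "'i \<Rightarrow> nat" where b: "\<And>j. \<mu> $ j = (\<Sum>i\<in>UNIV. int (b i) * C $ j $ i)"
    using \<mu>(1) unfolding Q_plus_iff by blast
  obtain b' :: "'i \<Rightarrow> nat" where b': "\<And>j. (- \<mu>) $ j = (\<Sum>i\<in>UNIV. int (b' i) * C $ j $ i)"
    using \<mu>(2) unfolding Q_plus_iff by blast
  have "(\<Sum>i\<in>UNIV. (int (b i) + int (b' i)) * C $ j $ i) = 0" for j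
    using b[of j] b'[of j] by (simp add: algebra_simps sum.distrib)
  then have "int (b i) + int (b' i) = 0" for i by (rule independent)
  then have "b i = 0" for i by (metis add_nonneg_eq_0_iff of_nat_0_le_iff of_nat_eq_0_iff)
  then show "\<mu> = 0" using b by (simp add: vec_eq_iff)
qed

end

section \<open>Weights of monomials and the convolution of series\<close>

lemma wt_eq_sum:
  fixes m :: "'i::finite monomial"
  assumes "finite K" "Poly_Mapping.keys m \<subseteq> K"
  shows "wt m $ i = (\<Sum>(j, a)\<in>K. if j = i then Poly_Mapping.lookup m (j, a) else 0)"
  unfolding wt_def vec_lambda_beta using assms
  by (intro sum.mono_neutral_left) (auto simp: in_keys_iff)

lemma wt_add: "wt (m + m') = wt m + wt m'" for m m' :: "'i::finite monomial"
proof -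
  define K where "K = Poly_Mapping.keys m \<union> Poly_Mapping.keys m'"
  have "finite K" by (simp add: K_def)
  moreover have "Poly_Mapping.keys (m + m') \<subseteq> K"
    using keys_add[of m m'] by (simp add: K_def)
  moreover have "Poly_Mapping.keys m \<subseteq> K" "Poly_Mapping.keys m' \<subseteq> K" by (auto simp: K_def)
  ultimately have "wt (m + m') $ i = wt m $ i + wt m' $ i" for i
    by (simp only: wt_eq_sum sum.distrib[symmetric]) (auto simp: lookup_add intro!: sum.cong)
  then show ?thesis by (simp add: vec_eq_iff)
qed

lemma wt_zero [simp]: "wt 0 = (0 :: 'i::finite weight)"
  by (simp add: wt_def vec_eq_iff)

lemma wt_minus: "wt (- m) = - wt m" for m :: "'i::finite monomial"
  using wt_add[of m "- m"] by (simp add: eq_neg_iff_add_eq_0 add.commute)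

lemma wt_diff: "wt (m - m') = wt m - wt m'" for m m' :: "'i::finite monomial"
  using wt_add[of m "- m'"] by (simp add: wt_minus)

lemma wt_sum: "wt (\<Sum>x\<in>S. g x) = (\<Sum>x\<in>S. wt (g x))" for g :: "'a \<Rightarrow> 'i::finite monomial"
  by (induction S rule: infinite_finite_induct) (simp_all add: wt_add)

lemma wt_Y: "wt (Y i a) $ j = (if j = i then 1 else 0)"
  by (simp add: wt_def Y_def)

lemma series_mult_mono: "series_mult (mono_series a) f m = f (m - a)"
proof -
  have "{m'. mono_series a m' \<noteq> 0 \<and> f (m - m') \<noteq> 0} = (if f (m - a) = 0 then {} else {a})"
    by (auto simp: mono_series_def)
  then show ?thesis by (simp add: series_mult_def mono_series_def)
qed

lemma series_mult_commute: "series_mult f g = series_mult g f"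
proof
  fix m
  have "bij_betw (\<lambda>m'. m - m') {m'. f m' \<noteq> 0 \<and> g (m - m') \<noteq> 0} {m'. g m' \<noteq> 0 \<and> f (m - m') \<noteq> 0}"
    by (rule bij_betw_byWitness[of _ "\<lambda>m'. m - m'"]) auto
  from sum.reindex_bij_betw[OF this, of "\<lambda>m'. g m' * f (m - m')"]
  show "series_mult f g m = series_mult g f m"
    by (simp add: series_mult_def mult.commute)
qed

context root_setting
begin

lemma carrier_Ytilde_iff:
  "f \<in> carrier (Ytilde w) \<longleftrightarrow>
    (\<exists>L. finite L \<and> (\<forall>m. f m \<noteq> 0 \<longrightarrow> (\<exists>\<mu>\<in>L. \<exists>\<beta>\<in>Q_plus. w (wt m) = \<mu> - \<beta>)))
    \<and> (\<forall>\<mu>. finite {m. f m \<noteq> 0 \<and> wt m = \<mu>})"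
  by (simp add: Ytilde_def)

lemma Ytilde_simps [simp]:
  "f \<otimes>\<^bsub>Ytilde w\<^esub> g = series_mult f g" "\<one>\<^bsub>Ytilde w\<^esub> = mono_series 0"
  "f \<oplus>\<^bsub>Ytilde w\<^esub> g = (\<lambda>m. f m + g m)"
  by (simp_all add: Ytilde_def)

lemma finite_support_in_Ytilde: "finite {m. f m \<noteq> 0} \<Longrightarrow> f \<in> carrier (Ytilde w)"
  unfolding carrier_Ytilde_iff
  by (intro conjI exI[of _ "(\<lambda>m. w (wt m)) ` {m. f m \<noteq> 0}"] allI)
    (auto intro: bexI[of _ 0])

lemma mono_series_closed: "mono_series m \<in> carrier (Ytilde w)"
  by (rule finite_support_in_Ytilde) (simp add: mono_series_def)

text \<open>After applying \<open>w\<close>, the weights of both factors are bounded above, and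
  their sum is fixed. The weight of \<open>a\<close> therefore lies in a finite union of intervals
  of \<open>Q_plus\<close>, and each weight carries only finitely many monomials. Fixing just the
  weight of \<open>a + b\<close> serves closure of the product as well as existence of its
  coefficients.\<close>

lemma finite_pairs:
  assumes w: "w \<in> weyl" and f: "f \<in> carrier (Ytilde w)" and g: "g \<in> carrier (Ytilde w)"
  shows "finite {(a, b). f a \<noteq> 0 \<and> g b \<noteq> 0 \<and> wt (a + b) = \<mu>}"
proof -
  obtain L where L: "finite L" "\<And>m. f m \<noteq> 0 \<Longrightarrow> \<exists>\<mu>\<in>L. \<exists>\<beta>\<in>Q_plus. w (wt m) = \<mu> - \<beta>"
    using f unfolding carrier_Ytilde_iff by blast
  obtain L' where L': "finite L'" "\<And>m. g m \<noteq> 0 \<Longrightarrow> \<exists>\<mu>\<in>L'. \<exists>\<beta>\<in>Q_plus. w (wt m) = \<mu> - \<beta>"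
    using g unfolding carrier_Ytilde_iff by blast
  define W where "W = w -` (\<Union>l\<in>L. \<Union>l'\<in>L'.
      (\<lambda>\<beta>. l - \<beta>) ` {\<beta> \<in> Q_plus. (l + l' - w \<mu>) - \<beta> \<in> Q_plus})"
  have "finite W"
    unfolding W_def using L(1) L'(1) finite_Q_plus_interval
    by (intro finite_vimageI weyl_inj w finite_UN_I finite_imageI) auto
  have "wt a \<in> W" if "f a \<noteq> 0" "g b \<noteq> 0" "wt (a + b) = \<mu>" for a b
  proof -
    obtain l \<beta> where 1: "l \<in> L" "\<beta> \<in> Q_plus" "w (wt a) = l - \<beta>" using L(2) \<open>f a \<noteq> 0\<close> by blast
    obtain l' \<beta>' where 2: "l' \<in> L'" "\<beta>' \<in> Q_plus" "w (wt b) = l' - \<beta>'" using L'(2) \<open>g b \<noteq> 0\<close> by blast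
    have "w \<mu> = l - \<beta> + (l' - \<beta>')" using that(3) 1 2 w by (auto simp: wt_add weyl_add)
    then have "(l + l' - w \<mu>) - \<beta> = \<beta>'" by simp
    then show ?thesis using 1 2 by (auto simp: W_def)
  qed
  then have "{(a, b). f a \<noteq> 0 \<and> g b \<noteq> 0 \<and> wt (a + b) = \<mu>}
      \<subseteq> (\<Union>\<nu>\<in>W. {a. f a \<noteq> 0 \<and> wt a = \<nu>}) \<times> (\<Union>\<nu>\<in>W. {b. g b \<noteq> 0 \<and> wt b = \<mu> - \<nu>})"
    by (auto simp: wt_add)
  moreover have "finite \<dots>"
    using f g \<open>finite W\<close> unfolding carrier_Ytilde_iff by blast
  ultimately show ?thesis by (rule finite_subset)
qed

lemma finite_convolution:
  assumes "w \<in> weyl" "f \<in> carrier (Ytilde w)" "g \<in> carrier (Ytilde w)"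
  shows "finite {a. f a \<noteq> 0 \<and> g (m - a) \<noteq> 0}"
proof -
  have "{a. f a \<noteq> 0 \<and> g (m - a) \<noteq> 0}
      \<subseteq> fst ` {(a, b). f a \<noteq> 0 \<and> g b \<noteq> 0 \<and> wt (a + b) = wt m}"
    by (force simp: image_iff)
  then show ?thesis using finite_pairs[OF assms, of "wt m"] by (auto intro: finite_subset)
qed

text \<open>The support of a product before cancellation. A coefficient of
  \<open>series_mult f g\<close> may vanish although pairs contribute to it, and the rearrangement
  of triple products has to keep those pairs.\<close>

definition support_product :: "'i series \<Rightarrow> 'i series \<Rightarrow> 'i series" where
  "support_product f g m = of_bool (\<exists>a. f a \<noteq> 0 \<and> g (m - a) \<noteq> 0)"

lemma support_product_closed:
  assumes w: "w \<in> weyl" and f: "f \<in> carrier (Ytilde w)" and g: "g \<in> carrier (Ytilde w)"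
  shows "support_product f g \<in> carrier (Ytilde w)"
proof -
  obtain L where L: "finite L" "\<And>m. f m \<noteq> 0 \<Longrightarrow> \<exists>\<mu>\<in>L. \<exists>\<beta>\<in>Q_plus. w (wt m) = \<mu> - \<beta>"
    using f unfolding carrier_Ytilde_iff by blast
  obtain L' where L': "finite L'" "\<And>m. g m \<noteq> 0 \<Longrightarrow> \<exists>\<mu>\<in>L'. \<exists>\<beta>\<in>Q_plus. w (wt m) = \<mu> - \<beta>"
    using g unfolding carrier_Ytilde_iff by blast
  have "\<exists>\<mu>\<in>(\<lambda>(l, l'). l + l') ` (L \<times> L'). \<exists>\<beta>\<in>Q_plus. w (wt m) = \<mu> - \<beta>"
    if "support_product f g m \<noteq> 0" for m
  proof -
    obtain a where a: "f a \<noteq> 0" "g (m - a) \<noteq> 0"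
      using \<open>support_product f g m \<noteq> 0\<close> by (auto simp: support_product_def)
    obtain l \<beta> where 1: "l \<in> L" "\<beta> \<in> Q_plus" "w (wt a) = l - \<beta>" using L(2) a by blast
    obtain l' \<beta>' where 2: "l' \<in> L'" "\<beta>' \<in> Q_plus" "w (wt (m - a)) = l' - \<beta>'" using L'(2) a by blast
    have "w (wt m) = w (wt a) + w (wt (m - a))"
      using w by (simp add: wt_diff weyl_diff)
    also have "\<dots> = (l + l') - (\<beta> + \<beta>')" using 1 2 by simp
    finally show ?thesis using 1 2 Q_plus_add by blast
  qed
  moreover have "finite ((\<lambda>(l, l'). l + l') ` (L \<times> L'))" using L L' by simp
  moreover have "finite {m. support_product f g m \<noteq> 0 \<and> wt m = \<mu>}" for \<mu>
  proof -
    have "{m. support_product f g m \<noteq> 0 \<and> wt m = \<mu>}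
        \<subseteq> (\<lambda>(a, b). a + b) ` {(a, b). f a \<noteq> 0 \<and> g b \<noteq> 0 \<and> wt (a + b) = \<mu>}"
      by (force simp: support_product_def)
    then show ?thesis using finite_pairs[OF assms] finite_subset by blast
  qed
  ultimately show ?thesis unfolding carrier_Ytilde_iff by blast
qed

lemma series_mult_support: "series_mult f g m \<noteq> 0 \<Longrightarrow> support_product f g m \<noteq> 0"
proof (rule ccontr)
  assume *: "series_mult f g m \<noteq> 0" "\<not> support_product f g m \<noteq> 0"
  then have "{a. f a \<noteq> 0 \<and> g (m - a) \<noteq> 0} = {}"
    by (auto simp: support_product_def)
  then have "series_mult f g m = 0" by (simp only: series_mult_def sum.empty)
  then show False using *(1) by contradiction
qed

lemma series_mult_closed:
  assumes "w \<in> weyl" "f \<in> carrier (Ytilde w)" "g \<in> carrier (Ytilde w)"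
  shows "series_mult f g \<in> carrier (Ytilde w)"
proof -
  have S: "support_product f g \<in> carrier (Ytilde w)" by (rule support_product_closed[OF assms])
  then obtain L where L: "finite L"
    "\<And>m. support_product f g m \<noteq> 0 \<Longrightarrow> \<exists>\<mu>\<in>L. \<exists>\<beta>\<in>Q_plus. w (wt m) = \<mu> - \<beta>"
    unfolding carrier_Ytilde_iff by blast
  have "finite {m. series_mult f g m \<noteq> 0 \<and> wt m = \<mu>}" for \<mu>
  proof (rule finite_subset)
    show "{m. series_mult f g m \<noteq> 0 \<and> wt m = \<mu>} \<subseteq> {m. support_product f g m \<noteq> 0 \<and> wt m = \<mu>}"
      using series_mult_support by auto
    show "finite {m. support_product f g m \<noteq> 0 \<and> wt m = \<mu>}"
      using S unfolding carrier_Ytilde_iff by blast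
  qed
  then show ?thesis
    unfolding carrier_Ytilde_iff
    by (intro conjI exI[of _ L] allI impI L series_mult_support)
qed

text \<open>An expression that treats the three factors alike, so that associativity becomes a
  relabelling of the summation variables.\<close>

lemma series_mult_triple:
  assumes w: "w \<in> weyl" and f: "f \<in> carrier (Ytilde w)" and g: "g \<in> carrier (Ytilde w)"
    and h: "h \<in> carrier (Ytilde w)"
  shows "series_mult (series_mult f g) h m =
    (\<Sum>(a, b) | f a \<noteq> 0 \<and> g b \<noteq> 0 \<and> h (m - a - b) \<noteq> 0. f a * g b * h (m - a - b))"
proof -
  \<comment> \<open>The outer index set is the uncancelled support; only then do the pairs of outer
    and inner indices match all triples on the right-hand side.\<close>
  define X where "X = {x. support_product f g x \<noteq> 0 \<and> h (m - x) \<noteq> 0}"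
  define P where "P x = {a. f a \<noteq> 0 \<and> g (x - a) \<noteq> 0}" for x
  have finX: "finite X"
    unfolding X_def by (rule finite_convolution[OF w support_product_closed[OF w f g] h])
  have finP: "finite (P x)" for x unfolding P_def by (rule finite_convolution[OF w f g])
  have "series_mult (series_mult f g) h m = (\<Sum>x\<in>X. series_mult f g x * h (m - x))"
    unfolding series_mult_def[of "series_mult f g"]
    using finX series_mult_support by (intro sum.mono_neutral_left) (auto simp: X_def)
  also have "\<dots> = (\<Sum>x\<in>X. \<Sum>a\<in>P x. f a * g (x - a) * h (m - x))"
    by (simp add: series_mult_def P_def sum_distrib_right)
  also have "\<dots> = (\<Sum>(x, a)\<in>Sigma X P. f a * g (x - a) * h (m - x))"
    using finX finP by (simp add: sum.Sigma)
  also have "\<dots> = (\<Sum>(a, b) | f a \<noteq> 0 \<and> g b \<noteq> 0 \<and> h (m - a - b) \<noteq> 0. f a * g b * h (m - a - b))"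
    by (rule sum.reindex_bij_witness[of _ "\<lambda>(a, b). (a + b, a)" "\<lambda>(x, a). (a, x - a)"])
      (auto simp: X_def P_def support_product_def algebra_simps intro!: exI)
  finally show ?thesis .
qed

text \<open>The products \<open>(f g) h\<close> and \<open>(g h) f\<close> are the same triple sum
  up to a cyclic relabelling, and commutativity moves \<open>f\<close> to the front.\<close>

lemma series_mult_assoc:
  assumes w: "w \<in> weyl" and f: "f \<in> carrier (Ytilde w)" and g: "g \<in> carrier (Ytilde w)"
    and h: "h \<in> carrier (Ytilde w)"
  shows "series_mult (series_mult f g) h = series_mult f (series_mult g h)"
proof
  fix m
  have "series_mult (series_mult f g) h m = series_mult (series_mult g h) f m"
    unfolding series_mult_triple[OF w f g h] series_mult_triple[OF w g h f]
    by (rule sum.reindex_bij_witness[of _ "\<lambda>(b, c). (m - b - c, b)" "\<lambda>(a, b). (b, m - a - b)"])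
      (auto simp: algebra_simps)
  then show "series_mult (series_mult f g) h m = series_mult f (series_mult g h) m"
    by (simp add: series_mult_commute[of f])
qed

lemma series_mult_one_left: "series_mult (mono_series 0) f = f"
  by (simp add: fun_eq_iff series_mult_mono)

lemma comm_monoid_Ytilde: "w \<in> weyl \<Longrightarrow> comm_monoid (Ytilde w)"
  by (rule comm_monoidI)
    (auto simp: series_mult_closed mono_series_closed series_mult_assoc series_mult_one_left
      intro: series_mult_commute)

lemma comm_monoid_Pi_ring: "comm_monoid Pi_ring"
proof (rule comm_monoidI)
  fix F G H
  assume FGH: "F \<in> carrier Pi_ring" "G \<in> carrier Pi_ring" "H \<in> carrier Pi_ring"
  show "F \<otimes>\<^bsub>Pi_ring\<^esub> G \<otimes>\<^bsub>Pi_ring\<^esub> H = F \<otimes>\<^bsub>Pi_ring\<^esub> (G \<otimes>\<^bsub>Pi_ring\<^esub> H)"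
    using FGH by (auto simp: Pi_ring_def fun_eq_iff restrict_def PiE_iff
        series_mult_assoc[where f = "F _" and g = "G _" and h = "H _"])
next
  fix F assume F: "F \<in> carrier Pi_ring"
  show "\<one>\<^bsub>Pi_ring\<^esub> \<otimes>\<^bsub>Pi_ring\<^esub> F = F"
    using F by (auto simp: Pi_ring_def series_mult_one_left PiE_iff extensional_def)
qed (auto simp: Pi_ring_def mono_series_closed PiE_iff
    intro: series_mult_closed restrict_ext series_mult_commute)

lemma Pi_mult: "w \<in> weyl \<Longrightarrow> (F \<otimes>\<^bsub>Pi_ring\<^esub> G) w = series_mult (F w) (G w)"
  by (simp add: Pi_ring_def)

lemma Pi_ring_eqI:
  "F \<in> extensional weyl \<Longrightarrow> G \<in> extensional weyl \<Longrightarrow> (\<And>w. w \<in> weyl \<Longrightarrow> F w = G w) \<Longrightarrow> F = G"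
  by (rule extensionalityI)

lemma Pi_mult_extensional: "F \<otimes>\<^bsub>Pi_ring\<^esub> G \<in> extensional weyl"
  by (simp add: Pi_ring_def)

lemma Pi_UnitsI:
  assumes "F \<in> extensional weyl" "\<And>w. w \<in> weyl \<Longrightarrow> F w \<in> Units (Ytilde w)"
  shows "F \<in> Units Pi_ring"
proof -
  have "\<forall>w\<in>weyl. \<exists>g\<in>carrier (Ytilde w). series_mult g (F w) = mono_series 0
      \<and> series_mult (F w) g = mono_series 0"
    using assms(2) by (simp add: Units_def)
  then obtain G where G: "\<And>w. w \<in> weyl \<Longrightarrow> G w \<in> carrier (Ytilde w)
      \<and> series_mult (G w) (F w) = mono_series 0 \<and> series_mult (F w) (G w) = mono_series 0"
    by metis
  have "restrict G weyl \<in> carrier Pi_ring" "F \<in> carrier Pi_ring"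
    using G assms by (auto simp: Pi_ring_def PiE_iff Units_def)
  moreover have "restrict G weyl \<otimes>\<^bsub>Pi_ring\<^esub> F = \<one>\<^bsub>Pi_ring\<^esub>"
      "F \<otimes>\<^bsub>Pi_ring\<^esub> restrict G weyl = \<one>\<^bsub>Pi_ring\<^esub>"
    using G by (auto simp: Pi_ring_def fun_eq_iff)
  ultimately show ?thesis by (auto simp: Units_def)
qed

lemma Pi_inv:
  assumes "F \<in> Units Pi_ring" "w \<in> weyl"
  shows "F w \<in> Units (Ytilde w)" "(inv\<^bsub>Pi_ring\<^esub> F) w = inv\<^bsub>Ytilde w\<^esub> (F w)"
proof -
  interpret P: comm_monoid Pi_ring by (rule comm_monoid_Pi_ring)
  interpret Yw: comm_monoid "Ytilde w" by (rule comm_monoid_Ytilde[OF assms(2)])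
  have closed: "F w \<in> carrier (Ytilde w)" "(inv\<^bsub>Pi_ring\<^esub> F) w \<in> carrier (Ytilde w)"
    using P.Units_closed[OF assms(1)] P.Units_inv_closed[OF assms(1)] assms(2)
    by (auto simp: Pi_ring_def)
  have "(F \<otimes>\<^bsub>Pi_ring\<^esub> inv\<^bsub>Pi_ring\<^esub> F) w = \<one>\<^bsub>Pi_ring\<^esub> w"
    using P.Units_r_inv[OF assms(1)] by simp
  then have r: "F w \<otimes>\<^bsub>Ytilde w\<^esub> (inv\<^bsub>Pi_ring\<^esub> F) w = \<one>\<^bsub>Ytilde w\<^esub>"
    using assms(2) by (simp add: Pi_ring_def)
  then show "F w \<in> Units (Ytilde w)"
    using closed by (auto simp: Units_def series_mult_commute[of _ "F w"])
  show "(inv\<^bsub>Pi_ring\<^esub> F) w = inv\<^bsub>Ytilde w\<^esub> (F w)"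
    using Yw.comm_inv_char[OF closed r] by simp
qed

end

section \<open>Invertibility and recursion of the series \<open>\<Sigma>\<close>\<close>

text \<open>Coefficients are counted by cardinality to agree with \<open>Sigma_plus\<close> and
  \<open>Sigma_minus\<close>; for injective \<open>N\<close> this is the indicator function of the
  range.\<close>

definition mono_sum :: "(nat \<Rightarrow> 'i monomial) \<Rightarrow> 'i series" where
  "mono_sum N = (\<lambda>m. int (card {k. m = N k}))"

lemma mono_sum_eq: "inj N \<Longrightarrow> mono_sum N m = of_bool (m \<in> range N)"
proof (cases "m \<in> range N")
  case True
  assume "inj N"
  obtain k where k: "m = N k" using True by auto
  then have "{k. m = N k} = {k}" using \<open>inj N\<close> by (auto simp: inj_def)
  then have "mono_sum N m = 1" by (simp add: mono_sum_def)
  then show ?thesis using True by simp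
next
  case False
  then have "{k. m = N k} = {}" by auto
  then have "mono_sum N m = 0" by (simp only: mono_sum_def card.empty of_nat_0)
  then show ?thesis using False by simp
qed

lemma mono_sum_mult:
  assumes "inj N"
  shows "series_mult (mono_sum N) g m = (\<Sum>k | g (m - N k) \<noteq> 0. g (m - N k))"
proof -
  have "{m'. mono_sum N m' \<noteq> 0 \<and> g (m - m') \<noteq> 0} = N ` {k. g (m - N k) \<noteq> 0}"
    by (auto simp: mono_sum_eq[OF assms])
  then show ?thesis
    using assms by (simp add: series_mult_def sum.reindex inj_on_subset mono_sum_eq)
qed

lemma mono_sum_Suc:
  assumes "inj N"
  shows "mono_sum N m = mono_series (N 0) m + mono_sum (\<lambda>k. N (Suc k)) m"
proof -
  have inj: "inj (\<lambda>k. N (Suc k))" using assms by (auto simp: inj_def)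
  have "m \<in> range N \<longleftrightarrow> m = N 0 \<or> m \<in> range (\<lambda>k. N (Suc k))"
    unfolding image_iff by (metis UNIV_I not0_implies_Suc)
  moreover have "N 0 \<noteq> N (Suc k)" for k using assms by (auto simp: inj_def)
  ultimately show ?thesis
    by (auto simp: mono_sum_eq[OF assms] mono_sum_eq[OF inj] mono_series_def)
qed

lemma mono_sum_shift: "mono_sum (\<lambda>k. c + N k) m = mono_sum N (m - c)"
proof -
  have "{k. m = c + N k} = {k. m - c = N k}" by (auto simp: algebra_simps)
  then show ?thesis by (simp add: mono_sum_def)
qed

text \<open>
  For \<open>N 0 = 0\<close>, the part of degree \<open>n\<close> of the inverse of the series \<open>\<Sum>\<^sub>k N k\<close>, where \<open>N k\<close> has
  degree \<open>k\<close>.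
\<close>

fun inv_part :: "(nat \<Rightarrow> 'i monomial) \<Rightarrow> nat \<Rightarrow> 'i series" where
  "inv_part N 0 m = (if m = 0 then 1 else 0)"
| "inv_part N (Suc n) m = - (\<Sum>k\<le>n. inv_part N (n - k) (m - N (Suc k)))"

text \<open>To be applied with \<open>X\<close> the set of products of inverses of the
  \<open>A j b\<close>: the recursion only adds exponents \<open>N k\<close>, so the inverse series
  stays supported in any additive submonoid containing them.\<close>

lemma inv_part_closed:
  assumes "0 \<in> X" "\<And>k. N k \<in> X" "\<And>x y. x \<in> X \<Longrightarrow> y \<in> X \<Longrightarrow> x + y \<in> X"
  shows "inv_part N n m \<noteq> 0 \<Longrightarrow> m \<in> X"
proof (induction n arbitrary: m rule: less_induct)
  case (less n)
  show ?case
  proof (cases n)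
    case 0
    then show ?thesis using less.prems assms(1) by (auto split: if_splits)
  next
    case (Suc n')
    then obtain k where "k \<le> n'" "inv_part N (n' - k) (m - N (Suc k)) \<noteq> 0"
      using less.prems by (auto elim: sum.not_neutral_contains_not_neutral)
    then have "m - N (Suc k) \<in> X" using less.IH[of "n' - k"] Suc by simp
    then have "(m - N (Suc k)) + N (Suc k) \<in> X" using assms(2,3) by blast
    then show ?thesis by simp
  qed
qed

lemma inv_part_finite: "finite {m. inv_part N n m \<noteq> 0}"
proof (induction n rule: less_induct)
  case (less n)
  show ?case
  proof (cases n)
    case 0
    then show ?thesis by simp
  next
    case (Suc n')
    have "{m. inv_part N n m \<noteq> 0}
        \<subseteq> (\<Union>k\<le>n'. (\<lambda>m. m + N (Suc k)) ` {m. inv_part N (n' - k) m \<noteq> 0})"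
    proof
      fix m assume "m \<in> {m. inv_part N n m \<noteq> 0}"
      then obtain k where "k \<le> n'" "inv_part N (n' - k) (m - N (Suc k)) \<noteq> 0"
        using Suc by (auto elim: sum.not_neutral_contains_not_neutral)
      then show "m \<in> (\<Union>k\<le>n'. (\<lambda>m. m + N (Suc k)) ` {m. inv_part N (n' - k) m \<noteq> 0})"
        by (intro UN_I[of k] image_eqI[of _ _ "m - N (Suc k)"]) auto
    qed
    moreover have "finite \<dots>" using less.IH Suc by auto
    ultimately show ?thesis by (rule finite_subset)
  qed
qed

lemma scale_eq_iff: "\<beta> \<noteq> 0 \<Longrightarrow> int n *s \<beta> = int k *s \<beta> \<longleftrightarrow> n = k" for \<beta> :: "int ^ 'i::finite"
  by (auto simp: vec_eq_iff)

lemma scale_add: "int n *s \<beta> + int k *s \<beta> = int (n + k) *s \<beta>" for \<beta> :: "int ^ 'i::finite"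
  by (simp add: vec_eq_iff algebra_simps)

lemma inv_part_wt:
  fixes N :: "nat \<Rightarrow> 'i::finite monomial"
  assumes "\<And>k. wt (N k) = int k *s \<beta>"
  shows "inv_part N n m \<noteq> 0 \<Longrightarrow> wt m = int n *s \<beta>"
proof (induction n arbitrary: m rule: less_induct)
  case (less n)
  show ?case
  proof (cases n)
    case 0
    then show ?thesis using less.prems by (auto simp: vec_eq_iff split: if_splits)
  next
    case (Suc n')
    then obtain k where k: "k \<le> n'" "inv_part N (n' - k) (m - N (Suc k)) \<noteq> 0"
      using less.prems by (auto elim: sum.not_neutral_contains_not_neutral)
    then have "wt (m - N (Suc k)) = int (n' - k) *s \<beta>" using less.IH[of "n' - k"] Suc by simp
    then have "wt m = int (n' - k) *s \<beta> + int (Suc k) *s \<beta>"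
      by (simp only: wt_diff assms diff_eq_eq)
    then show ?thesis using k Suc by (simp only: scale_add) simp
  qed
qed

text \<open>The parts of different degree have disjoint supports, because the degree is determined
  by the weight when \<open>\<beta>\<close> is nonzero; their infinite sum is thus a single term at
  each monomial. If the weight is no multiple of \<open>\<beta>\<close>, then \<open>THE\<close> is
  unspecified, but by \<open>inv_part_wt\<close> every part vanishes there.\<close>

definition mono_sum_inverse :: "(nat \<Rightarrow> 'i::finite monomial) \<Rightarrow> 'i weight \<Rightarrow> 'i series" where
  "mono_sum_inverse N \<beta> m = inv_part N (THE n. wt m = int n *s \<beta>) m"

context
  fixes N :: "nat \<Rightarrow> 'i::finite monomial" and \<beta> :: "'i weight"
  assumes N0: "N 0 = 0" and wtN: "\<And>k. wt (N k) = int k *s \<beta>" and \<beta>0: "\<beta> \<noteq> 0"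
begin

lemma inj_N: "inj N"
  using wtN scale_eq_iff[OF \<beta>0] by (metis injI)

lemma mono_sum_inverse_eq: "wt m = int n *s \<beta> \<Longrightarrow> mono_sum_inverse N \<beta> m = inv_part N n m"
  by (simp add: mono_sum_inverse_def scale_eq_iff[OF \<beta>0])

lemma mono_sum_inverse_wt: "mono_sum_inverse N \<beta> m \<noteq> 0 \<Longrightarrow> \<exists>n. wt m = int n *s \<beta>"
  using inv_part_wt[of N \<beta>, OF wtN] unfolding mono_sum_inverse_def by blast

lemma mono_sum_inverse_closed:
  assumes "0 \<in> X" "\<And>k. N k \<in> X" "\<And>x y. x \<in> X \<Longrightarrow> y \<in> X \<Longrightarrow> x + y \<in> X"
  shows "mono_sum_inverse N \<beta> m \<noteq> 0 \<Longrightarrow> m \<in> X"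
  unfolding mono_sum_inverse_def by (rule inv_part_closed[OF assms])

text \<open>At a monomial of degree \<open>n\<close> only the terms with \<open>k \<le> n\<close>
  contribute. For \<open>n > 0\<close> the term \<open>k = 0\<close> cancels the others, which is
  exactly the recursion of \<open>inv_part\<close>; in degree 0 only the constant 1 remains.\<close>

lemma mono_sum_mult_inverse: "series_mult (mono_sum N) (mono_sum_inverse N \<beta>) = mono_series 0"
proof
  fix m
  let ?I = "mono_sum_inverse N \<beta>"
  have deg: "\<exists>n. wt m = int (n + k) *s \<beta>" if I: "?I (m - N k) \<noteq> 0" for k
  proof -
    obtain n where "wt (m - N k) = int n *s \<beta>" using mono_sum_inverse_wt[OF I] by blast
    then have "wt m = int n *s \<beta> + int k *s \<beta>" by (simp only: wt_diff wtN diff_eq_eq)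
    then show ?thesis unfolding scale_add by blast
  qed
  show "series_mult (mono_sum N) ?I m = mono_series 0 m"
  proof (cases "\<exists>n. wt m = int n *s \<beta>")
    case False
    then have "?I (m - N k) = 0" for k using deg[of k] by metis
    then have "{k. ?I (m - N k) \<noteq> 0} = {}" by simp
    then have "series_mult (mono_sum N) ?I m = 0"
      by (simp only: mono_sum_mult[OF inj_N] sum.empty)
    moreover have "m \<noteq> 0" using False by (metis of_nat_0 vector_smult_lzero wt_zero)
    ultimately show ?thesis by (simp add: mono_series_def)
  next
    case True
    then obtain n where n: "wt m = int n *s \<beta>" by blast
    have "k \<le> n" if I: "?I (m - N k) \<noteq> 0" for k
    proof -
      obtain n' where "wt m = int (n' + k) *s \<beta>" using deg[OF I] by blast
      then have "n = n' + k" using n scale_eq_iff[OF \<beta>0] by metis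
      then show ?thesis by simp
    qed
    then have "{k. ?I (m - N k) \<noteq> 0} \<subseteq> {..n}" by auto
    then have "series_mult (mono_sum N) ?I m = (\<Sum>k\<le>n. ?I (m - N k))"
      unfolding mono_sum_mult[OF inj_N] by (intro sum.mono_neutral_left) auto
    also have "\<dots> = (\<Sum>k\<le>n. inv_part N (n - k) (m - N k))"
    proof (rule sum.cong)
      fix k assume "k \<in> {..n}"
      then have "wt m = int (n - k) *s \<beta> + int k *s \<beta>" unfolding scale_add by (simp add: n)
      then have "wt (m - N k) = int (n - k) *s \<beta>" by (simp add: wt_diff wtN)
      then show "?I (m - N k) = inv_part N (n - k) (m - N k)" by (rule mono_sum_inverse_eq)
    qed simp
    also have "\<dots> = mono_series 0 m"
    proof (cases n)
      case 0
      then show ?thesis by (simp add: N0 mono_series_def)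
    next
      case (Suc n')
      have "m \<noteq> 0"
        using n Suc scale_eq_iff[OF \<beta>0, of n 0] by auto
      moreover have "(\<Sum>k\<le>n. inv_part N (n - k) (m - N k)) = 0"
        unfolding Suc sum.atMost_Suc_shift by (simp add: N0)
      ultimately show ?thesis by (simp add: mono_series_def)
    qed
    finally show ?thesis .
  qed
qed

end

lemma series_mult_neg_left: "series_mult (\<lambda>m. - f m) g = (\<lambda>m. - series_mult f g m)"
  by (simp add: series_mult_def sum_negf)

context root_setting
begin

lemma neg_closed: "f \<in> carrier (Ytilde w) \<Longrightarrow> (\<lambda>m. - f m) \<in> carrier (Ytilde w)"
  by (simp add: carrier_Ytilde_iff)

lemma neg_Units:
  assumes "f \<in> Units (Ytilde w)"
  shows "(\<lambda>m. - f m) \<in> Units (Ytilde w)"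
proof -
  obtain g where g: "f \<in> carrier (Ytilde w)" "g \<in> carrier (Ytilde w)" "series_mult f g = mono_series 0"
    using assms by (auto simp: Units_def)
  have "series_mult (\<lambda>m. - f m) (\<lambda>m. - g m) = mono_series 0"
    unfolding series_mult_neg_left series_mult_commute[of f]
    unfolding series_mult_neg_left series_mult_commute[of g] by (simp add: g(3))
  then show ?thesis
    using g neg_closed unfolding Units_def
    by (auto simp: series_mult_commute[of _ "\<lambda>m. - f m"] intro!: bexI[of _ "\<lambda>m. - g m"])
qed

lemma mono_series_mult: "series_mult (mono_series a) (mono_series b) = mono_series (a + b)"
  by (auto simp: fun_eq_iff series_mult_mono) (auto simp: mono_series_def algebra_simps)

lemma mono_series_Units: "mono_series a \<in> Units (Ytilde w)"
  unfolding Units_def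
  by (auto simp: mono_series_closed mono_series_mult intro!: bexI[of _ "mono_series (- a)"])

text \<open>The map \<open>w\<close> sends every weight \<open>n \<beta>\<close> into the negative
  of \<open>Q_plus\<close>, so 0 alone bounds the support.\<close>

lemma graded_in_Ytilde:
  assumes w: "w \<in> weyl" and \<beta>: "- w \<beta> \<in> Q_plus" "\<beta> \<noteq> 0"
    and f: "\<And>m. f m \<noteq> 0 \<Longrightarrow> \<exists>n. wt m = int n *s \<beta>"
    and fin: "\<And>n. finite {m. f m \<noteq> 0 \<and> wt m = int n *s \<beta>}"
  shows "f \<in> carrier (Ytilde w)"
proof -
  have "\<exists>\<mu>\<in>{0}. \<exists>\<gamma>\<in>Q_plus. w (wt m) = \<mu> - \<gamma>" if "f m \<noteq> 0" for m
  proof -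
    obtain n where "wt m = int n *s \<beta>" using f \<open>f m \<noteq> 0\<close> by blast
    then have "w (wt m) = int n *s w \<beta>" using w by (simp add: weyl_scale)
    then have "w (wt m) = 0 - int n *s (- w \<beta>)" by (simp add: vec_eq_iff)
    then show ?thesis using Q_plus_scale[OF \<beta>(1)] by blast
  qed
  moreover have "finite {m. f m \<noteq> 0 \<and> wt m = \<mu>}" for \<mu>
  proof (cases "\<exists>n. \<mu> = int n *s \<beta>")
    case True
    then show ?thesis using fin by blast
  next
    case False
    then have "{m. f m \<noteq> 0 \<and> wt m = \<mu>} = {}" using f by blast
    then show ?thesis by (simp only: finite.emptyI)
  qed
  ultimately show ?thesis unfolding carrier_Ytilde_iff by blast
qed

lemma mono_sum_Units:
  assumes w: "w \<in> weyl" and \<beta>: "- w \<beta> \<in> Q_plus" "\<beta> \<noteq> 0"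
    and N: "N 0 = 0" "\<And>k. wt (N k) = int k *s \<beta>"
  shows "mono_sum N \<in> Units (Ytilde w)" "mono_sum_inverse N \<beta> \<in> carrier (Ytilde w)"
    "inv\<^bsub>Ytilde w\<^esub> (mono_sum N) = mono_sum_inverse N \<beta>"
proof -
  interpret Yw: comm_monoid "Ytilde w" by (rule comm_monoid_Ytilde[OF w])
  have inj: "inj N" by (rule inj_N[OF N \<beta>(2)])
  have 1: "mono_sum N \<in> carrier (Ytilde w)"
  proof (rule graded_in_Ytilde[OF w \<beta>])
    fix n
    have "{m. mono_sum N m \<noteq> 0 \<and> wt m = int n *s \<beta>} \<subseteq> {N n}"
      using N(2) scale_eq_iff[OF \<beta>(2)] by (auto simp: mono_sum_eq[OF inj])
    then show "finite {m. mono_sum N m \<noteq> 0 \<and> wt m = int n *s \<beta>}" by (rule finite_subset) simp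
  qed (use N(2) in \<open>auto simp: mono_sum_eq[OF inj]\<close>)
  show 2: "mono_sum_inverse N \<beta> \<in> carrier (Ytilde w)"
  proof (rule graded_in_Ytilde[OF w \<beta>])
    fix n
    have "{m. mono_sum_inverse N \<beta> m \<noteq> 0 \<and> wt m = int n *s \<beta>} \<subseteq> {m. inv_part N n m \<noteq> 0}"
      using mono_sum_inverse_eq[OF N \<beta>(2)] by auto
    then show "finite {m. mono_sum_inverse N \<beta> m \<noteq> 0 \<and> wt m = int n *s \<beta>}"
      using inv_part_finite by (rule finite_subset)
  qed (use mono_sum_inverse_wt[OF N \<beta>(2)] in blast)
  have 3: "mono_sum N \<otimes>\<^bsub>Ytilde w\<^esub> mono_sum_inverse N \<beta> = \<one>\<^bsub>Ytilde w\<^esub>"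
    using mono_sum_mult_inverse[OF N \<beta>(2)] by simp
  show "inv\<^bsub>Ytilde w\<^esub> (mono_sum N) = mono_sum_inverse N \<beta>"
    by (rule Yw.comm_inv_char[OF 1 2 3])
  show "mono_sum N \<in> Units (Ytilde w)"
    using 1 2 3 Yw.m_comm[OF 1 2] by (auto simp: Units_def)
qed

end

section \<open>Shifts of the spectral parameter\<close>

lemma cstar_eq_iff: "x = y \<longleftrightarrow> complex_of_cstar x = complex_of_cstar y"
  by (simp add: complex_of_cstar_inject)

lemma complex_of_cstar_nonzero [simp]: "complex_of_cstar x \<noteq> 0"
  using complex_of_cstar[of x] by simp

lemma complex_of_cstar_power [simp]: "complex_of_cstar (x ^ n) = complex_of_cstar x ^ n"
  by (induction n) (simp_all add: one_cstar.rep_eq times_cstar.rep_eq)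

lemma complex_of_cstar_powi [simp]: "complex_of_cstar (x powi n) = complex_of_cstar x powi n"
  by (simp add: power_int_def inverse_cstar.rep_eq)

lemma cstar_powi_0 [simp]: "x powi 0 = (1 :: cstar)"
  by (simp add: power_int_def)

lemma cstar_powi_add: "x powi (m + n) = x powi m * x powi n" for x :: cstar
  by (simp add: cstar_eq_iff times_cstar.rep_eq power_int_add)

lemma cstar_mult_left_cancel: "x * y = x * z \<longleftrightarrow> y = z" for x :: cstar
  by (simp add: cstar_eq_iff times_cstar.rep_eq)

lemma cstar_mult_inverse: "x * (inverse x * y) = y" for x :: cstar
  by (simp add: cstar_eq_iff times_cstar.rep_eq inverse_cstar.rep_eq)

text \<open>The shift by the inverse of \<open>a\<close> on monomials: it is the substitution by
  which \<open>tau a\<close> acts on coefficient functions.\<close>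

definition unscale :: "cstar \<Rightarrow> 'i monomial \<Rightarrow> 'i monomial" where
  "unscale a = Poly_Mapping.map_key (\<lambda>(i, b). (i, a * b))"

lemma inj_scale_key: "inj (\<lambda>(i :: 'i, b). (i, a * b :: cstar))"
  by (auto simp: inj_def cstar_mult_left_cancel)

lemma lookup_unscale: "Poly_Mapping.lookup (unscale a m) (i, b) = Poly_Mapping.lookup m (i, a * b)"
  unfolding unscale_def by (simp add: map_key.rep_eq[OF inj_scale_key])

lemma unscale_Y [simp]: "unscale a (Y i (a * b)) = Y i b"
  unfolding unscale_def Y_def
  using map_key_single[OF inj_scale_key, of a "(i, b)" 1] by simp

lemma unscale_add: "unscale a (m + m') = unscale a m + unscale a m'"
  by (rule poly_mapping_eqI) (auto simp: lookup_unscale lookup_add)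

lemma unscale_0 [simp]: "unscale a 0 = 0"
  by (rule poly_mapping_eqI) (auto simp: lookup_unscale)

lemma unscale_diff: "unscale a (m - m') = unscale a m - unscale a m'"
  by (rule poly_mapping_eqI) (auto simp: lookup_unscale lookup_minus)

lemma unscale_minus: "unscale a (- m) = - unscale a m"
  by (rule poly_mapping_eqI) (auto simp: lookup_unscale)

lemma unscale_sum: "unscale a (\<Sum>x\<in>S. g x) = (\<Sum>x\<in>S. unscale a (g x))"
  by (induction S rule: infinite_finite_induct) (simp_all add: unscale_add)

lemma unscale_eq_iff: "unscale a m = unscale a m' \<longleftrightarrow> m = m'" for m m' :: "'i monomial"
proof
  assume *: "unscale a m = unscale a m'"
  show "m = m'"
  proof (rule poly_mapping_eqI)
    fix p :: "'i \<times> cstar"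
    obtain i b where p: "p = (i, b)" by (metis surj_pair)
    have "Poly_Mapping.lookup (unscale a m) (i, inverse a * b)
        = Poly_Mapping.lookup (unscale a m') (i, inverse a * b)" using * by simp
    then show "Poly_Mapping.lookup m p = Poly_Mapping.lookup m' p"
      by (simp add: lookup_unscale cstar_mult_inverse p)
  qed
qed simp

lemma mono_series_unscale: "mono_series (unscale a m') (unscale a m) = mono_series m' m"
  by (simp add: mono_series_def unscale_eq_iff)

lemma mono_sum_unscale: "mono_sum (\<lambda>k. unscale a (N k)) (unscale a m) = mono_sum N m"
  by (simp add: mono_sum_def unscale_eq_iff)

section \<open>The two expansions of \<Sigma> and their common recursion\<close>

context root_setting
begin

lemma unscale_A [simp]: "unscale a (A i (a * b)) = A i b"
  unfolding A_def
  by (simp add: unscale_add unscale_diff unscale_sum mult.assoc)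

text \<open>The three sums in \<open>A\<close> account for the entries -1, -2, -3 with one, two and
  three variables. As these are the only nonzero off-diagonal entries, the weight is column
  \<open>i\<close> of \<open>C\<close>, the diagonal entry 2 coming from the two variables with
  index \<open>i\<close>.\<close>

lemma wt_A: "wt (A i a) = simple_root i"
proof -
  have s: "(\<Sum>j | C $ j $ i = c. if l = j then k else 0) = (if C $ l $ i = c then k else 0)"
    for c k :: int and l
    by (simp add: sum.delta)
  have "wt (A i a) $ l = C $ l $ i" for l
    using C_entries[of l i] C_diag[of i]
    by (cases "l = i") (auto simp: A_def wt_diff wt_add wt_sum wt_Y s sum.distrib)
  then show ?thesis by (simp add: vec_eq_iff)
qed

definition plus_exponent :: "'i \<Rightarrow> cstar \<Rightarrow> nat \<Rightarrow> 'i monomial" where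
  "plus_exponent i a k = (\<Sum>j\<in>{0<..k}. - A i (a * qi i powi (- 2 * int j + 2)))"

definition minus_exponent :: "'i \<Rightarrow> cstar \<Rightarrow> nat \<Rightarrow> 'i monomial" where
  "minus_exponent i a k = (\<Sum>j\<in>{0<..k}. A i (a * qi i powi (2 * int j)))"

lemma Sigma_plus_eq: "Sigma_plus i a = mono_sum (plus_exponent i a)"
  by (simp add: Sigma_plus_def mono_sum_def plus_exponent_def)

lemma Sigma_minus_eq: "Sigma_minus i a = (\<lambda>m. - mono_sum (\<lambda>k. minus_exponent i a (Suc k)) m)"
proof
  fix m
  have "{k. k > 0 \<and> m = minus_exponent i a k} = Suc ` {k. m = minus_exponent i a (Suc k)}"
    by (auto simp: image_iff gr0_conv_Suc)
  then show "Sigma_minus i a m = - mono_sum (\<lambda>k. minus_exponent i a (Suc k)) m"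
    by (simp add: Sigma_minus_def mono_sum_def minus_exponent_def[symmetric] card_image)
qed

lemma greaterThanAtMost_Suc: "{0<..Suc k} = insert (Suc k) {0<..k}"
  by auto

lemma plus_exponent_0 [simp]: "plus_exponent i a 0 = 0"
  and minus_exponent_0 [simp]: "minus_exponent i a 0 = 0"
  by (simp_all add: plus_exponent_def minus_exponent_def)

lemma plus_exponent_snoc:
    "plus_exponent i a (Suc k) = plus_exponent i a k - A i (a * qi i powi (- 2 * int k))"
  and minus_exponent_snoc:
    "minus_exponent i a (Suc k) = minus_exponent i a k + A i (a * qi i powi (2 * int k + 2))"
  by (simp_all add: plus_exponent_def minus_exponent_def greaterThanAtMost_Suc algebra_simps)

lemma shift_by_two: "a * qi i powi (-2) * qi i powi n = a * qi i powi (n - 2)"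
proof -
  have "qi i powi (-2) * qi i powi n = qi i powi (-2 + n)" by (simp only: cstar_powi_add)
  then show ?thesis by (simp add: mult.assoc)
qed

text \<open>Here the initial factor is split off instead of the last one: the other factors form the
  same chain started at \<open>a q\<^sub>i^(-2)\<close>. This is the step that turns a chain of
  monomials into a recursion.\<close>

lemma plus_exponent_Suc:
  "plus_exponent i a (Suc k) = plus_exponent i (a * qi i powi (-2)) k - A i a"
proof (induction k)
  case (Suc k)
  have "a * qi i powi (-2) * qi i powi (- 2 * int k) = a * qi i powi (- 2 * int (Suc k))"
    unfolding shift_by_two by (rule arg_cong[of _ _ "\<lambda>n. a * qi i powi n"]) simp
  then have "plus_exponent i (a * qi i powi (-2)) (Suc k)
      = plus_exponent i (a * qi i powi (-2)) k - A i (a * qi i powi (- 2 * int (Suc k)))"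
    by (simp only: plus_exponent_snoc)
  then show ?case unfolding plus_exponent_snoc[of i a "Suc k"] Suc.IH by simp
qed (simp add: plus_exponent_snoc)

lemma minus_exponent_Suc:
  "minus_exponent i (a * qi i powi (-2)) (Suc k) = minus_exponent i a k + A i a"
proof (induction k)
  case 0
  have "a * qi i powi (-2) * qi i powi (2 * int 0 + 2) = a" unfolding shift_by_two by simp
  then show ?case by (simp only: minus_exponent_snoc minus_exponent_0)
next
  case (Suc k)
  have "a * qi i powi (-2) * qi i powi (2 * int (Suc k) + 2) = a * qi i powi (2 * int k + 2)"
    unfolding shift_by_two by (rule arg_cong[of _ _ "\<lambda>n. a * qi i powi n"]) simp
  then show ?case
    unfolding minus_exponent_snoc[of i "a * qi i powi (-2)" "Suc k"] Suc.IH
      minus_exponent_snoc[of i a k] by simp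
qed

lemma wt_plus_exponent: "wt (plus_exponent i a k) = int k *s (- simple_root i)"
  by (induction k) (simp_all add: plus_exponent_snoc wt_diff wt_A vec_eq_iff algebra_simps)

lemma wt_minus_exponent: "wt (minus_exponent i a k) = int k *s simple_root i"
  by (induction k) (simp_all add: minus_exponent_snoc wt_add wt_A vec_eq_iff algebra_simps)

lemma inj_plus_exponent: "inj (plus_exponent i a)"
  using inj_N[OF plus_exponent_0 wt_plus_exponent] simple_root_nonzero by simp

lemma inj_minus_exponent: "inj (minus_exponent i a)"
  using inj_N[OF minus_exponent_0 wt_minus_exponent] simple_root_nonzero by simp

text \<open>In the expansion with positive sign, 1 is the term \<open>k = 0\<close> and all others
  contain the inverse of \<open>A i a\<close>. In the other expansion, multiplication by that
  inverse lowers each index by one and creates a term -1 at \<open>k = 0\<close>, which the summand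
  1 cancels.\<close>

lemma Sigma_recursion:
  "Sigma_w w i a m = mono_series 0 m
    + series_mult (mono_series (- A i a)) (Sigma_w w i (a * qi i powi (-2))) m"
proof (cases "w (simple_root i) \<in> pos_roots")
  case True
  have "mono_sum (\<lambda>k. plus_exponent i a (Suc k)) m
      = mono_sum (plus_exponent i (a * qi i powi (-2))) (m + A i a)"
    using mono_sum_shift[of "- A i a" "plus_exponent i (a * qi i powi (-2))" m]
    by (simp add: plus_exponent_Suc)
  then show ?thesis
    using True mono_sum_Suc[OF inj_plus_exponent, of i a m]
    by (simp add: Sigma_w_def Sigma_plus_eq series_mult_mono)
next
  case False
  have "mono_sum (\<lambda>k. minus_exponent i (a * qi i powi (-2)) (Suc k)) (m + A i a)
      = mono_sum (minus_exponent i a) m"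
    using mono_sum_shift[of "A i a" "minus_exponent i a" "m + A i a"]
    by (simp add: minus_exponent_Suc add.commute)
  then show ?thesis
    using False mono_sum_Suc[OF inj_minus_exponent, of i a m]
    by (simp add: Sigma_w_def Sigma_minus_eq series_mult_mono)
qed

lemma Sigma_unscale: "Sigma_w w i a (unscale b m) = Sigma_w w i (a * b) m"
proof -
  have A: "unscale b (A i (a * b * c)) = A i (a * c)" for c
    using unscale_A[of b i "a * c"] by (simp add: mult_ac)
  have e: "plus_exponent i a = (\<lambda>k. unscale b (plus_exponent i (a * b) k))"
    "minus_exponent i a = (\<lambda>k. unscale b (minus_exponent i (a * b) k))"
    by (simp_all add: fun_eq_iff plus_exponent_def minus_exponent_def unscale_sum unscale_minus A)
  show ?thesis
    unfolding Sigma_w_def Sigma_plus_eq Sigma_minus_eq e by (simp add: mono_sum_unscale)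
qed

lemma Sigma_Units:
  assumes w: "w \<in> weyl"
  shows "Sigma_w w i a \<in> Units (Ytilde w)"
proof (cases "w (simple_root i) \<in> pos_roots")
  case True
  then have "- w (- simple_root i) \<in> Q_plus" using w by (simp add: weyl_minus pos_roots_def)
  then have "mono_sum (plus_exponent i a) \<in> Units (Ytilde w)"
    using w simple_root_nonzero by (intro mono_sum_Units(1)) (auto simp: wt_plus_exponent)
  then show ?thesis using True by (simp add: Sigma_w_def Sigma_plus_eq)
next
  case False
  interpret Yw: comm_monoid "Ytilde w" by (rule comm_monoid_Ytilde[OF w])
  \<comment> \<open>The negative expansion has no constant term. Dividing by its leading monomial
    gives a sequence that starts at 0, as inversion requires; the leading monomial and the sign are
    units.\<close>
  define N where "N k = minus_exponent i a (Suc k) - minus_exponent i a 1" for k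
  have neg: "- w (simple_root i) \<in> Q_plus"
    using False weyl_roots[OF w simple_root_in_roots[of i]] roots_sign
    by (auto simp: pos_roots_def)
  have "wt (N k) = int k *s simple_root i" for k
    by (simp add: N_def wt_diff wt_minus_exponent vec_eq_iff algebra_simps)
  then have "mono_sum N \<in> Units (Ytilde w)"
    using w neg simple_root_nonzero by (intro mono_sum_Units(1)) (auto simp: N_def)
  then have "mono_series (minus_exponent i a 1) \<otimes>\<^bsub>Ytilde w\<^esub> mono_sum N \<in> Units (Ytilde w)"
    by (intro Yw.Units_m_closed mono_series_Units)
  moreover have "series_mult (mono_series (minus_exponent i a 1)) (mono_sum N)
      = mono_sum (\<lambda>k. minus_exponent i a (Suc k))"
    unfolding fun_eq_iff series_mult_mono mono_sum_shift[symmetric] by (simp add: N_def)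
  ultimately show ?thesis using False by (simp add: Sigma_w_def Sigma_minus_eq neg_Units)
qed

end

section \<open>The operators \<open>\<Theta>\<close> and the truncation\<close>

context comm_monoid
begin

lemma nat_pow_units_of: "x [^]\<^bsub>units_of G\<^esub> (n::nat) = x [^] n"
  by (simp add: nat_pow_def units_of_mult units_of_one)

text \<open>The images under \<Theta> are products of integer powers computed in a monoid. Passing
  to its group of units makes additivity in the exponent available.\<close>

lemma int_pow_units_of:
  assumes "x \<in> Units G"
  shows "x [^]\<^bsub>units_of G\<^esub> (n::int) = x [^] n"
proof -
  interpret U: comm_group "units_of G" by (rule units_comm_group)
  have "x [^] k \<in> Units G" for k :: nat
    using U.nat_pow_closed[of x k] assms by (simp add: units_of_carrier nat_pow_units_of)
  then show ?thesis
    unfolding int_pow_def2 nat_pow_units_of by (simp only: units_of_inv)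
qed

lemma finprod_units_of:
  assumes "f \<in> S \<rightarrow> Units G"
  shows "finprod (units_of G) f S = finprod G f S"
proof -
  interpret U: comm_group "units_of G" by (rule units_comm_group)
  show ?thesis
  proof (cases "finite S")
    case True
    then show ?thesis using assms
    proof (induction S)
      case (insert x S)
      then have "f \<in> S \<rightarrow> carrier (units_of G)" "f x \<in> carrier (units_of G)"
        by (auto simp: units_of_carrier)
      moreover have "f \<in> S \<rightarrow> carrier G" "f x \<in> carrier G" using insert.prems by auto
      ultimately show ?case using insert by (simp add: units_of_mult)
    qed (simp add: units_of_one)
  qed (simp add: units_of_one)
qed

end

text \<open>Exponents may cancel in \<open>m + m'\<close>, so the three index sets differ. Over the
  union of the keys of \<open>m\<close> and \<open>m'\<close> the additional factors are zeroth
  powers, and the products can be compared factor by factor.\<close>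

lemma (in comm_group) finprod_pow_add:
  assumes g: "\<And>p. g p \<in> carrier G"
  shows "(\<Otimes>p\<in>Poly_Mapping.keys (m + m'). g p [^] (Poly_Mapping.lookup (m + m') p :: int))
    = (\<Otimes>p\<in>Poly_Mapping.keys m. g p [^] Poly_Mapping.lookup m p)
      \<otimes> (\<Otimes>p\<in>Poly_Mapping.keys m'. g p [^] Poly_Mapping.lookup m' p)"
proof -
  define K where "K = Poly_Mapping.keys m \<union> Poly_Mapping.keys m'"
  have ext: "(\<Otimes>p\<in>Poly_Mapping.keys x. g p [^] (Poly_Mapping.lookup x p :: int))
      = (\<Otimes>p\<in>K. g p [^] Poly_Mapping.lookup x p)" if "Poly_Mapping.keys x \<subseteq> K" for x
    using that by (intro finprod_mono_neutral_cong_left)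
      (auto simp: K_def g in_keys_iff)
  have "Poly_Mapping.keys (m + m') \<subseteq> K"
    using keys_add[of m m'] by (simp add: K_def)
  moreover have "Poly_Mapping.keys m \<subseteq> K" "Poly_Mapping.keys m' \<subseteq> K" by (auto simp: K_def)
  ultimately show ?thesis
    by (simp only: ext) (simp add: lookup_add int_pow_mult g)
qed

section \<open>Images of monomials under \<Theta> and their membership in
  \<open>M_bar\<close>\<close>

context root_setting
begin

lemma Theta_gen_Units:
  assumes v: "v \<in> weyl"
  shows "Theta_gen i (v \<circ> refl i) p \<in> Units (Ytilde v)"
proof -
  interpret Yv: comm_monoid "Ytilde v" by (rule comm_monoid_Ytilde[OF v])
  obtain j a where p: "p = (j, a)" by (metis surj_pair)
  have "mono_series M \<otimes>\<^bsub>Ytilde v\<^esub> Sigma_w v i b \<otimes>\<^bsub>Ytilde v\<^esub> inv\<^bsub>Ytilde v\<^esub> (Sigma_w v i c)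
      \<in> Units (Ytilde v)" for M b c
    by (intro Yv.Units_m_closed Yv.Units_inv_Units mono_series_Units Sigma_Units v)
  then show ?thesis
    by (simp add: p Theta_gen_def Let_def mono_series_Units del: Ytilde_simps)
qed

lemma Theta_monomial_eq:
  assumes v: "v \<in> weyl"
  shows "Theta_monomial i (v \<circ> refl i) m = (\<Otimes>\<^bsub>units_of (Ytilde v)\<^esub>p\<in>Poly_Mapping.keys m.
    Theta_gen i (v \<circ> refl i) p [^]\<^bsub>units_of (Ytilde v)\<^esub> Poly_Mapping.lookup m p)"
proof -
  interpret Yv: comm_monoid "Ytilde v" by (rule comm_monoid_Ytilde[OF v])
  interpret U: comm_group "units_of (Ytilde v)" by (rule Yv.units_comm_group)
  have "Theta_gen i (v \<circ> refl i) p [^]\<^bsub>Ytilde v\<^esub> n \<in> Units (Ytilde v)" for p and n :: int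
    using U.int_pow_closed[of "Theta_gen i (v \<circ> refl i) p" n] Theta_gen_Units[OF v]
    by (simp add: units_of_carrier Yv.int_pow_units_of)
  then have "Theta_monomial i (v \<circ> refl i) m = finprod (units_of (Ytilde v))
      (\<lambda>p. Theta_gen i (v \<circ> refl i) p [^]\<^bsub>Ytilde v\<^esub> Poly_Mapping.lookup m p) (Poly_Mapping.keys m)"
    unfolding Theta_monomial_def refl_o_refl by (intro Yv.finprod_units_of[symmetric]) blast
  then show ?thesis by (simp only: Yv.int_pow_units_of[OF Theta_gen_Units[OF v]])
qed

definition Theta_mono :: "'i \<Rightarrow> 'i monomial \<Rightarrow> ('i weight \<Rightarrow> 'i weight) \<Rightarrow> 'i series" where
  "Theta_mono i m = Theta i (diag (mono_series m))"

lemma Theta_mono_nth: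
  assumes v: "v \<in> weyl"
  shows "Theta_mono i m v = Theta_monomial i (v \<circ> refl i) m"
proof
  fix m'
  let ?T = "Theta_monomial i (v \<circ> refl i)"
  have "{x. mono_series m x \<noteq> 0 \<and> ?T x m' \<noteq> 0} = (if ?T m m' = 0 then {} else {m})"
    by (auto simp: mono_series_def)
  then have "Theta_w i (v \<circ> refl i) (mono_series m) m' = ?T m m'"
    by (simp add: Theta_w_def mono_series_def)
  then show "Theta_mono i m v m' = ?T m m'"
    using v weyl_refl[OF v] by (simp add: Theta_mono_def Theta_def diag_def)
qed

lemma Theta_mono_extensional: "Theta_mono i m \<in> extensional weyl"
  by (simp add: Theta_mono_def Theta_def)

lemma Theta_mono_Units: "Theta_mono i m \<in> Units Pi_ring"
proof (rule Pi_UnitsI[OF Theta_mono_extensional])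
  fix v assume v: "v \<in> weyl"
  interpret Yv: comm_monoid "Ytilde v" by (rule comm_monoid_Ytilde[OF v])
  interpret U: comm_group "units_of (Ytilde v)" by (rule Yv.units_comm_group)
  have "Theta_monomial i (v \<circ> refl i) m \<in> carrier (units_of (Ytilde v))"
    unfolding Theta_monomial_eq[OF v]
    by (intro U.finprod_closed) (use Theta_gen_Units[OF v] in \<open>auto simp: units_of_carrier[symmetric]\<close>)
  then show "Theta_mono i m v \<in> Units (Ytilde v)"
    by (simp add: Theta_mono_nth[OF v] units_of_carrier)
qed

lemma Theta_mono_add: "Theta_mono i (m + m') = Theta_mono i m \<otimes>\<^bsub>Pi_ring\<^esub> Theta_mono i m'"
proof (rule Pi_ring_eqI[OF Theta_mono_extensional Pi_mult_extensional])
  fix v assume v: "v \<in> weyl"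
  interpret Yv: comm_monoid "Ytilde v" by (rule comm_monoid_Ytilde[OF v])
  interpret U: comm_group "units_of (Ytilde v)" by (rule Yv.units_comm_group)
  show "Theta_mono i (m + m') v = (Theta_mono i m \<otimes>\<^bsub>Pi_ring\<^esub> Theta_mono i m') v"
    unfolding Pi_mult[OF v] Theta_mono_nth[OF v] Theta_monomial_eq[OF v]
    by (subst U.finprod_pow_add) (use Theta_gen_Units[OF v] in \<open>auto simp: units_of_carrier units_of_mult\<close>)
qed

lemma Theta_mono_Y:
  assumes v: "v \<in> weyl"
  shows "Theta_mono i (Y j a) v = Theta_gen i (v \<circ> refl i) (j, a)"
proof -
  interpret Yv: comm_monoid "Ytilde v" by (rule comm_monoid_Ytilde[OF v])
  interpret U: comm_group "units_of (Ytilde v)" by (rule Yv.units_comm_group)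
  show ?thesis
    unfolding Theta_mono_nth[OF v] Theta_monomial_eq[OF v]
    using Theta_gen_Units[OF v] by (simp add: Y_def units_of_carrier[symmetric])
qed

lemma Theta_mono_diff:
  "Theta_mono i (m - m') = Theta_mono i m \<otimes>\<^bsub>Pi_ring\<^esub> inv\<^bsub>Pi_ring\<^esub> Theta_mono i m'"
proof -
  interpret P: comm_monoid Pi_ring by (rule comm_monoid_Pi_ring)
  have c: "Theta_mono i x \<in> carrier Pi_ring" for x using Theta_mono_Units by (rule P.Units_closed)
  have "Theta_mono i m = Theta_mono i (m - m') \<otimes>\<^bsub>Pi_ring\<^esub> Theta_mono i m'"
    by (simp add: Theta_mono_add[symmetric])
  then have "Theta_mono i m \<otimes>\<^bsub>Pi_ring\<^esub> inv\<^bsub>Pi_ring\<^esub> Theta_mono i m'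
      = Theta_mono i (m - m') \<otimes>\<^bsub>Pi_ring\<^esub> (Theta_mono i m' \<otimes>\<^bsub>Pi_ring\<^esub> inv\<^bsub>Pi_ring\<^esub> Theta_mono i m')"
    using c Theta_mono_Units by (simp add: P.m_assoc)
  then show ?thesis using c Theta_mono_Units by simp
qed

lemma Theta_mono_0: "Theta_mono i 0 = \<one>\<^bsub>Pi_ring\<^esub>"
proof -
  interpret P: comm_monoid Pi_ring by (rule comm_monoid_Pi_ring)
  show ?thesis using Theta_mono_diff[of i 0 0] Theta_mono_Units[of i 0] by simp
qed

definition Sigma_family :: "'i \<Rightarrow> cstar \<Rightarrow> ('i weight \<Rightarrow> 'i weight) \<Rightarrow> 'i series" where
  "Sigma_family i a = (\<lambda>w\<in>weyl. Sigma_w w i a)"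

lemma q_powi_eq_qi: "q powi (- (2 * int (d i))) = qi i powi (-2)"
proof -
  have "complex_of_cstar q powi (- (2 * int (d i))) = (complex_of_cstar q ^ d i) powi (-2)"
    by (simp add: power_int_minus power_int_mult power_mult[symmetric] mult.commute)
  then show ?thesis by (simp add: cstar_eq_iff qi_def)
qed

lemma tau_mono: "tau b (diag (mono_series (unscale b m))) = diag (mono_series m)"
  by (simp add: tau_def diag_def unscale_def[symmetric] mono_series_unscale cong: restrict_cong)

lemma Sigma_family_is_f_family:
  "is_f_family (diag (mono_series (- A i 1))) (2 * int (d i)) (Sigma_family i)"
  unfolding is_f_family_def
proof (intro conjI allI)
  fix a b
  show "Sigma_family i a \<in> Units Pi_ring"
    by (rule Pi_UnitsI) (simp_all add: Sigma_family_def Sigma_Units)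
  show "tau b (Sigma_family i a) = Sigma_family i (a * b)"
    by (simp add: tau_def Sigma_family_def unscale_def[symmetric] Sigma_unscale cong: restrict_cong)
  have "- A i 1 = unscale a (- A i a)"
    using unscale_A[of a i 1] by (simp add: unscale_minus)
  then have tau: "tau a (diag (mono_series (- A i 1))) = diag (mono_series (- A i a))"
    by (simp only: tau_mono)
  show "Sigma_family i a = \<one>\<^bsub>Pi_ring\<^esub> \<oplus>\<^bsub>Pi_ring\<^esub> tau a (diag (mono_series (- A i 1)))
      \<otimes>\<^bsub>Pi_ring\<^esub> Sigma_family i (a * q powi - (2 * int (d i)))"
    unfolding tau q_powi_eq_qi
    by (rule Pi_ring_eqI)
      (auto simp: Pi_ring_def Sigma_family_def diag_def fun_eq_iff Sigma_recursion[of _ i a])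
qed

lemma varpi_mono: "varpi (mono_series m) = a_root (wt m)"
proof
  fix \<mu>
  have "{x. wt x = \<mu> \<and> mono_series m x \<noteq> 0} = (if \<mu> = wt m then {m} else {})"
    by (auto simp: mono_series_def)
  then show "varpi (mono_series m) \<mu> = a_root (wt m) \<mu>"
    by (simp add: varpi_def a_root_def mono_series_def)
qed

lemma Sigma_family_in_f_elements: "Sigma_family i a \<in> f_elements (G_level 0)"
proof -
  have "varpi (mono_series (- A i 1)) = a_root (- simple_root i)"
    by (simp add: varpi_mono wt_minus wt_A)
  then have "diag (mono_series (- A i 1)) \<in> adm (G_level 0)"
    using minus_simple_root_in_roots by (auto simp: adm_def diag_def)
  then show ?thesis
    using Sigma_family_is_f_family[of i] d_pos[of i]
    by (auto simp: f_elements_def intro!: exI bexI)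
qed

lemma diag_mono_Units: "diag (mono_series m) \<in> Units Pi_ring"
  by (rule Pi_UnitsI) (simp_all add: diag_def mono_series_Units)

lemma G_level_1_subgroup: "subgroup (G_level 1) (units_of Pi_ring)"
proof -
  interpret P: comm_monoid Pi_ring by (rule comm_monoid_Pi_ring)
  interpret U: comm_group "units_of Pi_ring" by (rule P.units_comm_group)
  have "G_level 0 \<union> f_elements (G_level 0) \<subseteq> carrier (units_of Pi_ring)"
    by (auto simp: units_of_carrier diag_mono_Units f_elements_def is_f_family_def)
  then have "subgroup (G_level (Suc 0)) (units_of Pi_ring)"
    unfolding G_level.simps(2) by (rule U.generate_is_subgroup)
  then show ?thesis by simp
qed

lemma Theta_mono_Y_same:
  "Theta_mono i (Y i a) = diag (mono_series (Y i a - A i (a * qi i powi (-1))))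
    \<otimes>\<^bsub>Pi_ring\<^esub> Sigma_family i (a * qi i powi (-3))
    \<otimes>\<^bsub>Pi_ring\<^esub> inv\<^bsub>Pi_ring\<^esub> Sigma_family i (a * qi i powi (-1))"
proof (rule Pi_ring_eqI[OF Theta_mono_extensional Pi_mult_extensional])
  fix v assume v: "v \<in> weyl"
  have "Sigma_family i b \<in> Units Pi_ring" for b
    by (rule Pi_UnitsI) (simp_all add: Sigma_family_def Sigma_Units)
  then have "(inv\<^bsub>Pi_ring\<^esub> Sigma_family i b) v = inv\<^bsub>Ytilde v\<^esub> (Sigma_w v i b)" for b
    using Pi_inv(2)[of "Sigma_family i b" v] v by (simp add: Sigma_family_def)
  then show "Theta_mono i (Y i a) v = (diag (mono_series (Y i a - A i (a * qi i powi (-1))))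
    \<otimes>\<^bsub>Pi_ring\<^esub> Sigma_family i (a * qi i powi (-3))
    \<otimes>\<^bsub>Pi_ring\<^esub> inv\<^bsub>Pi_ring\<^esub> Sigma_family i (a * qi i powi (-1))) v"
    using v by (simp add: Theta_mono_Y Pi_mult Theta_gen_def Let_def diag_def Sigma_family_def)
qed

lemma Theta_mono_Y_other:
  assumes "j \<noteq> i"
  shows "Theta_mono i (Y j a) = diag (mono_series (Y j a))"
  by (rule Pi_ring_eqI[OF Theta_mono_extensional])
    (use assms in \<open>auto simp: diag_def Theta_mono_Y Theta_gen_def\<close>)

text \<open>Monomials form the free abelian group on the pairs \<open>(j, a)\<close>. Since
  \<open>G_level 1\<close> is a group, it suffices to treat single variables and differences of
  exponents.\<close>

lemma Theta_mono_in_G_level: "Theta_mono i m \<in> G_level 1"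
proof -
  interpret P: comm_monoid Pi_ring by (rule comm_monoid_Pi_ring)
  interpret H: subgroup "G_level 1" "units_of Pi_ring" by (rule G_level_1_subgroup)
  have gen: "x \<in> G_level 1" if "x \<in> G_level 0 \<union> f_elements (G_level 0)" for x
    using that by (simp add: generate.incl del: G_level.simps(1))
  have mult: "x \<otimes>\<^bsub>Pi_ring\<^esub> y \<in> G_level 1" if "x \<in> G_level 1" "y \<in> G_level 1" for x y
    using H.m_closed[OF that] by (simp add: units_of_mult)
  have minv: "inv\<^bsub>Pi_ring\<^esub> x \<in> G_level 1" if "x \<in> G_level 1" for x
    using H.m_inv_closed[OF that] H.mem_carrier[OF that]
    by (simp add: units_of_carrier P.units_of_inv)
  have mono: "diag (mono_series x) \<in> G_level 1" for x
    by (rule gen) simp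
  have Sigma: "Sigma_family i a \<in> G_level 1" for a
    by (rule gen) (use Sigma_family_in_f_elements in blast)
  show ?thesis
    using subset_UNIV
  proof (induction m rule: frag_induction)
    case zero
    then show ?case using H.one_closed by (simp add: Theta_mono_0 units_of_one)
  next
    case (one p)
    obtain j a where p: "p = (j, a)" by (metis surj_pair)
    have "Theta_mono i (Y j a) \<in> G_level 1"
    proof (cases "j = i")
      case True
      then show ?thesis unfolding True Theta_mono_Y_same by (intro mult minv mono Sigma)
    next
      case False
      then show ?thesis unfolding Theta_mono_Y_other[OF False] by (intro mono)
    qed
    then show ?case by (simp only: Y_def p)
  next
    case (diff x y)
    then show ?case unfolding Theta_mono_diff by (intro mult minv)
  qed
qed

lemma Theta_mono_in_M_bar: "Theta_mono i m \<in> M_bar"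
  unfolding M_bar_def using Theta_mono_in_G_level by (intro generate.incl) blast

section \<open>Series in the inverses of the \<open>A j b\<close>\<close>

definition A_sum :: "('i \<times> cstar \<Rightarrow>\<^sub>0 nat) \<Rightarrow> 'i monomial" where
  "A_sum v = (\<Sum>(j, b)\<in>Poly_Mapping.keys v. \<Sum>_<Poly_Mapping.lookup v (j, b). A j b)"

lemma A_inv_monomials_eq: "A_inv_monomials = range (\<lambda>v. - A_sum v)"
  by (auto simp: A_inv_monomials_def A_sum_def)

lemma A_sum_superset:
  "finite K \<Longrightarrow> Poly_Mapping.keys v \<subseteq> K
    \<Longrightarrow> A_sum v = (\<Sum>(j, b)\<in>K. \<Sum>_<Poly_Mapping.lookup v (j, b). A j b)"
  unfolding A_sum_def by (rule sum.mono_neutral_left) (auto simp: in_keys_iff)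

lemma sum_lessThan_const_add: "(\<Sum>_<m + n. c) = (\<Sum>_<m. c) + (\<Sum>_<n. c)"
  for c :: "'a::comm_monoid_add" and m n :: nat
  by (induction n) (simp_all add: add.assoc)

lemma A_sum_add: "A_sum (v + v') = A_sum v + A_sum v'"
proof -
  define K where "K = Poly_Mapping.keys v \<union> Poly_Mapping.keys v'"
  have "finite K" by (simp add: K_def)
  moreover have "Poly_Mapping.keys (v + v') \<subseteq> K"
    using keys_add[of v v'] by (simp add: K_def)
  moreover have "Poly_Mapping.keys v \<subseteq> K" "Poly_Mapping.keys v' \<subseteq> K" by (auto simp: K_def)
  ultimately show ?thesis
    by (simp only: A_sum_superset sum.distrib[symmetric])
      (auto simp: lookup_add sum_lessThan_const_add intro!: sum.cong)
qed

lemma A_inv_monomials_0: "0 \<in> A_inv_monomials"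
  unfolding A_inv_monomials_eq by (intro image_eqI[of _ _ 0]) (simp_all add: A_sum_def)

lemma A_inv_monomials_A: "- A j b \<in> A_inv_monomials"
  unfolding A_inv_monomials_eq
  by (intro image_eqI[of _ _ "Poly_Mapping.single (j, b) 1"]) (simp_all add: A_sum_def)

lemma A_inv_monomials_add:
  "x \<in> A_inv_monomials \<Longrightarrow> y \<in> A_inv_monomials \<Longrightarrow> x + y \<in> A_inv_monomials"
  unfolding A_inv_monomials_eq
  by (elim rangeE) (auto intro!: image_eqI simp: A_sum_add[symmetric] algebra_simps)

text \<open>Exponents with the same index \<open>j\<close> are collected over all spectral
  parameters; their total is the coefficient of the simple root with index \<open>j\<close>.\<close>

lemma wt_A_sum:
  "wt (A_sum v) $ l = (\<Sum>j\<in>UNIV. int (\<Sum>p\<in>Poly_Mapping.keys v.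
      if fst p = j then Poly_Mapping.lookup v p else 0) * C $ l $ j)"
proof -
  have "wt (\<Sum>_<n. A j b) $ l = int n * C $ l $ j" for n :: nat and j b
    by (induction n) (simp_all add: wt_add wt_A algebra_simps)
  then have "wt (A_sum v) $ l = (\<Sum>p\<in>Poly_Mapping.keys v. int (Poly_Mapping.lookup v p) * C $ l $ fst p)"
    by (simp add: A_sum_def wt_sum case_prod_beta)
  also have "\<dots> = (\<Sum>p\<in>Poly_Mapping.keys v. \<Sum>j\<in>UNIV.
      if j = fst p then int (Poly_Mapping.lookup v p) * C $ l $ j else 0)"
    by simp
  also have "\<dots> = (\<Sum>j\<in>UNIV. \<Sum>p\<in>Poly_Mapping.keys v.
      int (if fst p = j then Poly_Mapping.lookup v p else 0) * C $ l $ j)"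
    by (subst sum.swap) (auto intro!: sum.cong)
  finally show ?thesis by (simp only: sum_distrib_right of_nat_sum)
qed

lemma A_inv_monomials_wt: "m \<in> A_inv_monomials \<Longrightarrow> - wt m \<in> Q_plus"
proof -
  assume "m \<in> A_inv_monomials"
  then obtain v where "m = - A_sum v" by (auto simp: A_inv_monomials_eq)
  then have m: "- wt m = wt (A_sum v)" by (simp add: wt_minus)
  show ?thesis unfolding m Q_plus_iff wt_A_sum by (intro exI allI) (rule refl)
qed

text \<open>By independence of the simple roots the total exponent for each index vanishes. It is a
  sum of natural numbers, so every single exponent vanishes.\<close>

lemma A_inv_monomials_wt_0:
  assumes "m \<in> A_inv_monomials" "wt m = 0"
  shows "m = 0"
proof -
  obtain v where v: "m = - A_sum v" using assms(1) by (auto simp: A_inv_monomials_eq)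
  let ?c = "\<lambda>j. \<Sum>p\<in>Poly_Mapping.keys v. if fst p = j then Poly_Mapping.lookup v p else 0"
  have "(\<Sum>j\<in>UNIV. int (?c j) * C $ l $ j) = 0" for l
    using assms(2) wt_A_sum[of v l] by (simp add: v wt_minus)
  then have "int (?c j) = 0" for j by (rule independent)
  then have c: "?c j = 0" for j by (simp only: of_nat_eq_0_iff)
  have "Poly_Mapping.keys v = {}"
  proof (rule equals0I)
    fix p assume p: "p \<in> Poly_Mapping.keys v"
    have "(if fst p = fst p then Poly_Mapping.lookup v p else 0) = 0"
      using c[of "fst p"] p by (subst (asm) sum_eq_0_iff) auto
    then show False using p by (simp add: in_keys_iff)
  qed
  then show ?thesis by (simp add: v A_sum_def)
qed

lemma A_inv_monomials_pointed: "m \<in> A_inv_monomials \<Longrightarrow> - m \<in> A_inv_monomials \<Longrightarrow> m = 0"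
  using A_inv_monomials_wt[of m] A_inv_monomials_wt[of "- m"] Q_plus_pointed[of "wt m"]
    A_inv_monomials_wt_0[of m] by (simp add: wt_minus)

text \<open>The support lies in a monoid without nontrivial inverses, so only the constant terms of
  the two factors contribute to the constant term of the product.\<close>

lemma A_inv_series_mult:
  assumes "S \<in> A_inv_series" "S' \<in> A_inv_series"
  shows "series_mult S S' \<in> A_inv_series" "series_mult S S' 0 = S 0 * S' 0"
proof -
  have supp: "\<And>m. S m \<noteq> 0 \<Longrightarrow> m \<in> A_inv_monomials" "\<And>m. S' m \<noteq> 0 \<Longrightarrow> m \<in> A_inv_monomials"
    and carr: "S \<in> carrier (Ytilde id)" "S' \<in> carrier (Ytilde id)"
    using assms by (auto simp: A_inv_series_def)
  have "m \<in> A_inv_monomials" if "series_mult S S' m \<noteq> 0" for m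
  proof -
    have "support_product S S' m \<noteq> 0" using series_mult_support[OF that] .
    then obtain a where "S a \<noteq> 0" "S' (m - a) \<noteq> 0" by (auto simp: support_product_def)
    then have "a + (m - a) \<in> A_inv_monomials" using supp A_inv_monomials_add by blast
    then show ?thesis by simp
  qed
  then show "series_mult S S' \<in> A_inv_series"
    using series_mult_closed[OF weyl_id carr] by (simp add: A_inv_series_def)
  have "{m. S m \<noteq> 0 \<and> S' (0 - m) \<noteq> 0} \<subseteq> {0}"
    using supp A_inv_monomials_pointed by fastforce
  then have "series_mult S S' 0 = (\<Sum>m\<in>{0}. S m * S' (0 - m))"
    unfolding series_mult_def by (intro sum.mono_neutral_left) auto
  then show "series_mult S S' 0 = S 0 * S' 0" by simp
qed

text \<open>The condition on the inverse is imposed rather than derived, so that closure under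
  division does not require inverting an arbitrary series in the inverses of the
  \<open>A j b\<close>. That the inverse has constant term 1 then follows.\<close>

definition normalized_units :: "'i series set" where
  "normalized_units = {S \<in> Units (Ytilde id). S \<in> A_inv_series \<and> inv\<^bsub>Ytilde id\<^esub> S \<in> A_inv_series \<and> S 0 = 1}"

lemma normalized_units_one: "mono_series 0 \<in> normalized_units"
proof -
  interpret Ye: comm_monoid "Ytilde id" by (rule comm_monoid_Ytilde[OF weyl_id])
  have "inv\<^bsub>Ytilde id\<^esub> (mono_series 0) = mono_series 0" using Ye.inv_one by simp
  moreover have "mono_series 0 \<in> A_inv_series"
    using A_inv_monomials_0 by (simp add: A_inv_series_def mono_series_closed) (simp add: mono_series_def)
  ultimately show ?thesis
    using mono_series_Units[of 0 id] by (auto simp: normalized_units_def mono_series_def)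
qed

lemma normalized_units_mult:
  assumes "S \<in> normalized_units" "S' \<in> normalized_units"
  shows "series_mult S S' \<in> normalized_units"
proof -
  interpret Ye: comm_monoid "Ytilde id" by (rule comm_monoid_Ytilde[OF weyl_id])
  interpret U: comm_group "units_of (Ytilde id)" by (rule Ye.units_comm_group)
  have S: "S \<in> Units (Ytilde id)" "S' \<in> Units (Ytilde id)"
    using assms by (auto simp: normalized_units_def)
  have "inv\<^bsub>Ytilde id\<^esub> (S \<otimes>\<^bsub>Ytilde id\<^esub> S') = inv\<^bsub>Ytilde id\<^esub> S \<otimes>\<^bsub>Ytilde id\<^esub> inv\<^bsub>Ytilde id\<^esub> S'"
    using U.inv_mult[of S S'] S Ye.Units_m_closed[OF S]
    by (simp add: units_of_carrier Ye.units_of_inv units_of_mult)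
  then show ?thesis
    using assms Ye.Units_m_closed[OF S] by (auto simp: normalized_units_def A_inv_series_mult)
qed

lemma normalized_units_inv:
  assumes "S \<in> normalized_units"
  shows "inv\<^bsub>Ytilde id\<^esub> S \<in> normalized_units"
proof -
  interpret Ye: comm_monoid "Ytilde id" by (rule comm_monoid_Ytilde[OF weyl_id])
  have S: "S \<in> Units (Ytilde id)" "S \<in> A_inv_series" "inv\<^bsub>Ytilde id\<^esub> S \<in> A_inv_series" "S 0 = 1"
    using assms by (auto simp: normalized_units_def)
  have "series_mult S (inv\<^bsub>Ytilde id\<^esub> S) = mono_series 0"
    using Ye.Units_r_inv[OF S(1)] by simp
  then have "S 0 * (inv\<^bsub>Ytilde id\<^esub> S) 0 = 1"
    using A_inv_series_mult(2)[OF S(2,3)] by (simp add: mono_series_def)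
  then show ?thesis using S by (simp add: normalized_units_def)
qed

text \<open>In the identity component the simple root is positive, so the positive expansion occurs.
  Its terms are products of inverses of \<open>A\<close>, and \<open>mono_sum_inverse_closed\<close>
  carries this over to its inverse.\<close>

lemma Sigma_normalized: "Sigma_w id i a \<in> normalized_units"
proof -
  have pos: "simple_root i \<in> pos_roots"
    by (simp add: pos_roots_def simple_root_in_roots simple_root_in_Q_plus)
  then have eq: "Sigma_w id i a = mono_sum (plus_exponent i a)"
    by (simp add: Sigma_w_def Sigma_plus_eq)
  have \<beta>: "- id (- simple_root i) \<in> Q_plus" "- simple_root i \<noteq> 0"
    using simple_root_in_Q_plus simple_root_nonzero by simp_all
  have inv: "mono_sum (plus_exponent i a) \<in> Units (Ytilde id)"
    "mono_sum_inverse (plus_exponent i a) (- simple_root i) \<in> carrier (Ytilde id)"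
    "inv\<^bsub>Ytilde id\<^esub> (mono_sum (plus_exponent i a))
      = mono_sum_inverse (plus_exponent i a) (- simple_root i)"
    by (rule mono_sum_Units[OF weyl_id \<beta> plus_exponent_0 wt_plus_exponent])+
  have mem: "plus_exponent i a k \<in> A_inv_monomials" for k
  proof (induction k)
    case (Suc k)
    then show ?case
      using A_inv_monomials_add[OF Suc A_inv_monomials_A] by (simp add: plus_exponent_snoc)
  qed (simp add: A_inv_monomials_0)
  have "m \<in> A_inv_monomials" if "mono_sum_inverse (plus_exponent i a) (- simple_root i) m \<noteq> 0" for m
    by (rule mono_sum_inverse_closed[OF plus_exponent_0[of i a] wt_plus_exponent[of i a] \<beta>(2)
        A_inv_monomials_0 mem A_inv_monomials_add that])
  then have "mono_sum_inverse (plus_exponent i a) (- simple_root i) \<in> A_inv_series"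
    unfolding A_inv_series_def using inv(2) by blast
  moreover have "mono_sum (plus_exponent i a) \<in> A_inv_series"
    using Sigma_Units[OF weyl_id, of i a] mem
    by (auto simp: A_inv_series_def Units_def eq mono_sum_eq[OF inj_plus_exponent])
  moreover have "mono_sum (plus_exponent i a) 0 = 1"
    unfolding mono_sum_eq[OF inj_plus_exponent]
    using range_eqI[of 0 "plus_exponent i a" 0] by simp
  ultimately show ?thesis
    unfolding normalized_units_def eq mem_Collect_eq inv(3) using inv(1) by blast
qed

section \<open>The Chari operator as the leading monomial of \<Theta>\<close>

definition chari :: "'i \<Rightarrow> 'i monomial \<Rightarrow> 'i monomial" where
  "chari i = frag_extend (\<lambda>(j, a). Y j a - (if i = j then A i (a * qi i powi (-1)) else 0))"

lemma chari_add: "chari i (m + m') = chari i m + chari i m'"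
  by (simp add: chari_def frag_extend_add)

lemma chari_diff: "chari i (m - m') = chari i m - chari i m'"
  by (simp add: chari_def frag_extend_diff)

lemma chari_0 [simp]: "chari i 0 = 0"
  by (simp add: chari_def)

lemma chari_Y: "chari i (Y j a) = Y j a - (if i = j then A i (a * qi i powi (-1)) else 0)"
  by (simp add: chari_def Y_def)

lemma Pi_one: "w \<in> weyl \<Longrightarrow> \<one>\<^bsub>Pi_ring\<^esub> w = mono_series 0"
  by (simp add: Pi_ring_def)

text \<open>Requiring the cofactor to lie in the group \<open>normalized_units\<close> makes the
  factorisation stable under division, as induction over a free abelian group demands.\<close>

lemma Theta_mono_leading:
  "\<exists>S\<in>normalized_units. Theta_mono i m id = series_mult (mono_series (chari i m)) S"
  using subset_UNIV
proof (induction m rule: frag_induction)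
  case zero
  show ?case
    unfolding Theta_mono_0 Pi_one[OF weyl_id]
    by (rule bexI[OF _ normalized_units_one]) (simp add: mono_series_mult)
next
  case (one p)
  interpret Ye: comm_monoid "Ytilde id" by (rule comm_monoid_Ytilde[OF weyl_id])
  obtain j a where p: "p = (j, a)" by (metis surj_pair)
  have "\<exists>S\<in>normalized_units. Theta_mono i (Y j a) id = series_mult (mono_series (chari i (Y j a))) S"
  proof (cases "j = i")
    case True
    let ?S = "Sigma_w id i (a * qi i powi (-3))" and ?S' = "Sigma_w id i (a * qi i powi (-1))"
    have U: "?S \<in> Units (Ytilde id)" "?S' \<in> Units (Ytilde id)" by (simp_all add: Sigma_Units weyl_id)
    have "Theta_mono i (Y j a) id = mono_series (chari i (Y j a)) \<otimes>\<^bsub>Ytilde id\<^esub> ?S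
        \<otimes>\<^bsub>Ytilde id\<^esub> inv\<^bsub>Ytilde id\<^esub> ?S'"
      using refl_o_refl[of id i]
      by (simp add: True Theta_mono_Y[OF weyl_id] Theta_gen_def Let_def chari_Y del: Ytilde_simps)
    also have "\<dots> = mono_series (chari i (Y j a)) \<otimes>\<^bsub>Ytilde id\<^esub> (?S \<otimes>\<^bsub>Ytilde id\<^esub> inv\<^bsub>Ytilde id\<^esub> ?S')"
      by (intro Ye.m_assoc mono_series_closed Ye.Units_closed[OF U(1)] Ye.Units_inv_closed[OF U(2)])
    finally have "Theta_mono i (Y j a) id
        = series_mult (mono_series (chari i (Y j a))) (series_mult ?S (inv\<^bsub>Ytilde id\<^esub> ?S'))"
      by simp
    moreover have "series_mult ?S (inv\<^bsub>Ytilde id\<^esub> ?S') \<in> normalized_units"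
      by (intro normalized_units_mult normalized_units_inv Sigma_normalized)
    ultimately show ?thesis by blast
  next
    case False
    then show ?thesis
      by (intro bexI[OF _ normalized_units_one])
        (simp add: Theta_mono_Y_other diag_def weyl_id chari_Y mono_series_mult)
  qed
  then show ?case by (simp only: Y_def p)
next
  case (diff x y)
  interpret Ye: comm_monoid "Ytilde id" by (rule comm_monoid_Ytilde[OF weyl_id])
  interpret U: comm_group "units_of (Ytilde id)" by (rule Ye.units_comm_group)
  obtain S where S: "S \<in> normalized_units"
      "Theta_mono i x id = series_mult (mono_series (chari i x)) S"
    using diff.IH(1) by blast
  obtain S' where S': "S' \<in> normalized_units"
      "Theta_mono i y id = series_mult (mono_series (chari i y)) S'"
    using diff.IH(2) by blast
  have u: "S \<in> Units (Ytilde id)" "S' \<in> Units (Ytilde id)"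
    using S(1) S'(1) by (auto simp: normalized_units_def)
  have inv_mono: "inv\<^bsub>Ytilde id\<^esub> mono_series z = mono_series (- z)" for z
    by (rule Ye.comm_inv_char) (simp_all add: mono_series_closed mono_series_mult)
  have "inv\<^bsub>Ytilde id\<^esub> (mono_series (chari i y) \<otimes>\<^bsub>Ytilde id\<^esub> S')
      = mono_series (- chari i y) \<otimes>\<^bsub>Ytilde id\<^esub> inv\<^bsub>Ytilde id\<^esub> S'"
    using U.inv_mult[of "mono_series (chari i y)" S'] u(2)
      Ye.Units_m_closed[OF mono_series_Units u(2), of "chari i y"]
    by (simp add: units_of_carrier Ye.units_of_inv units_of_mult mono_series_Units inv_mono)
  then have "Theta_mono i (x - y) id = (mono_series (chari i x) \<otimes>\<^bsub>Ytilde id\<^esub> S)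
      \<otimes>\<^bsub>Ytilde id\<^esub> (mono_series (- chari i y) \<otimes>\<^bsub>Ytilde id\<^esub> inv\<^bsub>Ytilde id\<^esub> S')"
    using S(2) S'(2)
    by (simp add: Theta_mono_diff Pi_mult weyl_id Pi_inv(2) Theta_mono_Units)
  also have "\<dots> = (mono_series (chari i x) \<otimes>\<^bsub>Ytilde id\<^esub> mono_series (- chari i y))
      \<otimes>\<^bsub>Ytilde id\<^esub> (S \<otimes>\<^bsub>Ytilde id\<^esub> inv\<^bsub>Ytilde id\<^esub> S')"
  proof -
    have c: "S \<in> carrier (Ytilde id)" "inv\<^bsub>Ytilde id\<^esub> S' \<in> carrier (Ytilde id)"
      "mono_series z \<in> carrier (Ytilde id)" for z
      by (fact Ye.Units_closed[OF u(1)] Ye.Units_inv_closed[OF u(2)] mono_series_closed)+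
    show ?thesis using c by (simp add: Ye.m_ac del: Ytilde_simps)
  qed
  also have "\<dots> = series_mult (mono_series (chari i (x - y))) (series_mult S (inv\<^bsub>Ytilde id\<^esub> S'))"
    by (simp add: mono_series_mult chari_diff)
  finally have "Theta_mono i (x - y) id
      = series_mult (mono_series (chari i (x - y))) (series_mult S (inv\<^bsub>Ytilde id\<^esub> S'))" .
  moreover have "series_mult S (inv\<^bsub>Ytilde id\<^esub> S') \<in> normalized_units"
    by (intro normalized_units_mult normalized_units_inv S(1) S'(1))
  ultimately show ?case by blast
qed

lemma Lambda_Theta_mono: "Lambda (Theta_mono i m) = chari i m"
proof -
  obtain S where S: "S \<in> normalized_units"
      "Theta_mono i m id = series_mult (mono_series (chari i m)) S"
    using Theta_mono_leading by blast
  have S1: "S \<in> A_inv_series" "S 0 = 1" using S(1) by (auto simp: normalized_units_def)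
  have "(THE M. \<exists>S\<in>A_inv_series. (S 0 = 1 \<or> S 0 = -1) \<and>
      Theta_mono i m id = mono_series M \<otimes>\<^bsub>Ytilde id\<^esub> S) = chari i m"
  proof (rule the_equality)
    show "\<exists>S\<in>A_inv_series. (S 0 = 1 \<or> S 0 = -1) \<and>
        Theta_mono i m id = mono_series (chari i m) \<otimes>\<^bsub>Ytilde id\<^esub> S"
      using S(2) S1 by auto
    fix M
    assume "\<exists>S\<in>A_inv_series. (S 0 = 1 \<or> S 0 = -1) \<and>
        Theta_mono i m id = mono_series M \<otimes>\<^bsub>Ytilde id\<^esub> S"
    then obtain S' where S': "S' \<in> A_inv_series" "S' 0 = 1 \<or> S' 0 = -1"
        "Theta_mono i m id = series_mult (mono_series M) S'" by auto
    have eq: "S (x - chari i m) = S' (x - M)" for x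
      using arg_cong[OF trans[OF S(2)[symmetric] S'(3)], of "\<lambda>f. f x"] by (simp add: series_mult_mono)
    \<comment> \<open>The two factorisations are compared at both leading monomials. Each comparison
      puts a difference of these monomials into \<open>A_inv_monomials\<close>, in opposite
      directions, and pointedness identifies them.\<close>
    have "S' (chari i m - M) \<noteq> 0" using eq[of "chari i m"] S1(2) by simp
    then have 1: "chari i m - M \<in> A_inv_monomials" using S'(1) by (simp add: A_inv_series_def)
    have "S (M - chari i m) \<noteq> 0" using eq[of M] S'(2) by auto
    then have "M - chari i m \<in> A_inv_monomials" using S1(1) by (simp add: A_inv_series_def)
    then have "chari i m - M = 0" using 1 by (intro A_inv_monomials_pointed) auto
    then show "M = chari i m" by simp
  qed
  then show ?thesis using Theta_mono_in_M_bar by (simp add: Lambda_def)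
qed

section \<open>Bijectivity of the Chari operator\<close>

lemma lookup_Y: "Poly_Mapping.lookup (Y j a) (i, b) = (if j = i \<and> a = b then 1 else 0)"
  by (simp add: Y_def lookup_single when_def)

text \<open>As the diagonal entry is 2, the index \<open>i\<close> occurs in none of the three sums
  of \<open>A\<close>. Two separate conditionals are added, so the formula remains correct if the
  two parameters coincide.\<close>

lemma lookup_A_same:
  "Poly_Mapping.lookup (A i a) (i, b)
    = (if b = a * qi i powi (-1) then 1 else 0) + (if b = a * qi i then 1 else 0)"
proof -
  have z: "Poly_Mapping.lookup (\<Sum>j | C $ j $ i = c. g j) (i, b) = 0"
    if "c \<noteq> 2" "\<And>j. j \<noteq> i \<Longrightarrow> Poly_Mapping.lookup (g j) (i, b) = 0" for c g
    unfolding lookup_sum using that(1) C_diag by (auto intro!: sum.neutral that(2))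
  have "Poly_Mapping.lookup (\<Sum>j | C $ j $ i = -1. Y j x) (i, b) = 0"
    "Poly_Mapping.lookup (\<Sum>j | C $ j $ i = -2. Y j x + Y j y) (i, b) = 0"
    "Poly_Mapping.lookup (\<Sum>j | C $ j $ i = -3. Y j x + Y j y + Y j z) (i, b) = 0" for x y z
    by (rule z; simp add: lookup_add lookup_Y)+
  then show ?thesis by (simp add: A_def lookup_minus lookup_add lookup_Y eq_commute[of _ b])
qed

lemma cstar_powi_neg_eq_iff: "x = a * y powi (- n) \<longleftrightarrow> x * y powi n = a" for x a y :: cstar
  by (auto simp: cstar_eq_iff times_cstar.rep_eq power_int_minus field_simps)

text \<open>The monomial subtracted from \<open>Y i a\<close> contains \<open>Y i a\<close> itself,
  which cancels, and \<open>Y i (a * qi i powi (-2))\<close>, which survives with exponent -1. The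
  variables with other indices do not affect these exponents.\<close>

lemma lookup_chari:
  "Poly_Mapping.lookup (chari i m) (i, b) = - Poly_Mapping.lookup m (i, b * qi i powi 2)"
  using subset_UNIV
proof (induction m rule: frag_induction)
  case (one p)
  obtain j a where p: "p = (j, a)" by (metis surj_pair)
  have "a * qi i powi (-1) * qi i powi (-1) = a * qi i powi (-2)"
    by (simp only: mult.assoc cstar_powi_add[symmetric]) simp
  moreover have "a * qi i powi (-1) * qi i = a"
    by (simp add: cstar_eq_iff times_cstar.rep_eq inverse_cstar.rep_eq)
  ultimately have "Poly_Mapping.lookup (chari i (Y j a)) (i, b)
      = - Poly_Mapping.lookup (Y j a) (i, b * qi i powi 2)"
    using cstar_powi_neg_eq_iff[of b a "qi i" 2]
    by (auto simp: chari_Y lookup_minus lookup_A_same lookup_Y)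
  then show ?case by (simp only: Y_def p)
qed (simp_all add: chari_diff lookup_minus)

lemma chari_fixes:
  assumes "\<And>b. Poly_Mapping.lookup m (i, b) = 0"
  shows "chari i m = m"
proof -
  have "chari i m = frag_extend frag_of m"
    unfolding chari_def using assms by (intro frag_extend_eq) (auto simp: Y_def in_keys_iff)
  then show ?thesis by (simp only: frag_expansion[symmetric])
qed

text \<open>By \<open>lookup_chari\<close>, a monomial in the kernel has no variables with index
  \<open>i\<close>. The operator fixes such a monomial, so it is trivial.\<close>

lemma inj_chari: "inj (chari i)"
proof (rule injI)
  fix m m' assume "chari i m = chari i m'"
  then have 0: "chari i (m - m') = 0" by (simp add: chari_diff)
  have "Poly_Mapping.lookup (m - m') (i, b) = 0" for b
  proof -
    have "b * qi i powi (-2) * qi i powi 2 = b"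
      by (simp add: cstar_eq_iff times_cstar.rep_eq power_int_minus)
    then show ?thesis
      using lookup_chari[of i "m - m'" "b * qi i powi (-2)"] unfolding 0 by simp
  qed
  then have "m - m' = 0" using chari_fixes[of "m - m'" i] 0 by simp
  then show "m = m'" by simp
qed

lemma surj_chari: "surj (chari i)"
proof -
  have "m \<in> range (chari i)" for m
    using subset_UNIV
  proof (induction m rule: frag_induction)
    case zero
    show ?case by (rule range_eqI[of _ _ 0]) simp
  next
    case (diff x y)
    then show ?case by (auto simp: chari_diff[symmetric])
  next
    case (one p)
    obtain j b where p: "p = (j, b)" by (metis surj_pair)
    have "Y j b \<in> range (chari i)"
    proof (cases "j = i")
      case False
      then show ?thesis by (intro range_eqI[of _ _ "Y j b"]) (simp add: chari_Y)
    next
      case True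
      \<comment> \<open>The image of \<open>Z\<close> is the inverse of \<open>Y i b\<close> times
        variables with other indices. Hence \<open>chari i Z + Y i b\<close> is fixed, and
        subtracting \<open>Z\<close> from it gives a preimage of \<open>Y i b\<close>.\<close>
      define Z where "Z = Y i (b * qi i powi 2)"
      have "b * qi i powi 2 = x * qi i powi 2 \<longleftrightarrow> x = b" for x
        by (auto simp: cstar_eq_iff times_cstar.rep_eq)
      then have "chari i (chari i Z + Y i b) = chari i Z + Y i b"
        by (intro chari_fixes) (auto simp: lookup_add lookup_chari Z_def lookup_Y)
      then have "chari i (chari i Z + Y i b - Z) = Y i b" by (simp add: chari_diff)
      then show ?thesis unfolding True by (metis rangeI)
    qed
    then show ?case by (simp only: Y_def p)
  qed
  then show ?thesis by auto
qed

lemma chari_iso: "chari i \<in> iso monomial_group monomial_group"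
  using inj_chari surj_chari
  by (auto simp: iso_def hom_def monomial_group_def chari_add bij_betw_def)

end

theorem proposition6p10:
  fixes sc :: "complex \<Rightarrow> 'g::ab_group_add \<Rightarrow> 'g"
    and br :: "'g \<Rightarrow> 'g \<Rightarrow> 'g"
    and C :: "int ^ 'i::finite ^ 'i"
    and h e f :: "'i \<Rightarrow> 'g"
    and d :: "'i \<Rightarrow> nat"
    and q :: cstar
    and \<Delta> :: "'i weight set"
    and i :: 'i
  assumes "simple_lie_algebra_cartan sc br C h e f"
    and "\<Delta> = lie_roots sc br h"
    and "is_symmetrizer C d"
    and "\<And>k::nat. k > 0 \<Longrightarrow> q ^ k \<noteq> 1"
  shows "(\<forall>m. cartan_setting.Theta C d q \<Delta> i (cartan_setting.diag C (mono_series m))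
                \<in> cartan_setting.M_bar C q \<Delta>)
       \<and> (\<lambda>m. cartan_setting.Lambda C d q \<Delta>
               (cartan_setting.Theta C d q \<Delta> i (cartan_setting.diag C (mono_series m))))
           \<in> iso monomial_group monomial_group
       \<and> (\<forall>j a. cartan_setting.Lambda C d q \<Delta>
               (cartan_setting.Theta C d q \<Delta> i (cartan_setting.diag C (mono_series (Y j a))))
             = Y j a - (if i = j
                        then cartan_setting.A C d q i (a * cartan_setting.qi d q i powi (-1))
                        else 0))"
proof -
  interpret L: simple_lie_algebra_cartan sc br C h e f by (rule assms(1))
  interpret R: root_setting C d q \<Delta>
  proof
    show "c i = 0" if "\<And>j. (\<Sum>i\<in>UNIV. c i * C $ j $ i) = 0" for c i
      using L.simple_roots_independent[OF assms(3) that] .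
    show "d i > 0" for i using assms(3) by (simp add: is_symmetrizer_def)
    show "\<alpha> \<in> cartan_setting.Q_plus C \<or> - \<alpha> \<in> cartan_setting.Q_plus C" if "\<alpha> \<in> \<Delta>" for \<alpha>
      using that L.weights_positive_or_negative by (simp add: assms(2) L.lie_roots_eq)
  qed (use L.C_diag L.cartan_entries[OF assms(3)] L.roots_refl L.sroot_is_root L.minus_sroot_is_root
      in \<open>auto simp: assms(2)\<close>)
  have "(\<lambda>m. R.Lambda (R.Theta i (R.diag (mono_series m)))) = R.chari i"
    using R.Lambda_Theta_mono by (simp add: R.Theta_mono_def fun_eq_iff)
  then show ?thesis
    using R.Theta_mono_in_M_bar R.chari_iso R.chari_Y by (simp add: R.Theta_mono_def fun_eq_iff)
qed

end
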